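(* Let $\alpha,\beta\in(0,1)$ with $0<\alpha+\beta<1$, $\beta<1/e$, let $n\ge4$ and let $B\ge2\alpha^{-2}\log(6/\beta)$. Then, for an absolute constant $c>0$, the uniform separation rate of the permutation independence tests $\widehat\psi_{\nu,n}(\alpha)$, $\nu\in\mathcal V$, $$\rho\{\widehat\psi_{\nu,n}(\alpha),\beta\}=\inf\Big\{\rho>0:\ \sup_{\nu\in\mathcal V}\ \sup_{\mathbb P^{X,Y}\in\mathcal F_\nu(\rho)}\mathrm P\big(\widehat\psi_{\nu,n}(\alpha)=0\big)\le\beta\Big\},$$ satisfies $$\rho\{\widehat\psi_{\nu,n}(\alpha),\beta\}\le c\,n^{-1/2}\{\log(\alpha^{-1})+\log(\beta^{-1})\}.$$
   Context: $\mathcal H$ is a real separable infinite-dimensional Hilbert space with inner product $\langle\cdot,\cdot\rangle$; $\mathcal V$ is the set of Borel probability measures $\nu$ on $\mathcal H$ that are symmetric ($\nu(B)=\nu(-B)$ for all Borel $B$) with $\operatorname{supp}(\nu)=\mathcal H$; $\varphi_\nu(w)=\int_{\mathcal H}\exp(\mathrm i\langle w,z\rangle)\nu(\mathrm dz)$. Data: i.i.d. copies $(X_1,Y_1),\dots,(X_n,Y_n)$ of an $\mathcal H^2$-valued random variable $(X,Y)$ with distribution $\mathbb P^{X,Y}$. With $\varphi_X(w)=\mathbb E e^{\mathrm i\langle X,w\rangle}$, $\varphi_Y(w)=\mathbb E e^{\mathrm i\langle Y,w\rangle}$, $\varphi_{X,Y}(w_1,w_2)=\mathbb E e^{\mathrm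 i\langle X,w_1\rangle+\mathrm i\langle Y,w_2\rangle}$, the local alternatives are $$\mathcal F_\nu(\rho)=\Big\{\mathbb P^{X,Y}:\int_{\mathcal H^2}|\varphi_{X,Y}(w_1,w_2)-\varphi_X(w_1)\varphi_Y(w_2)|^2\nu(\mathrm dw_1)\nu(\mathrm dw_2)\ge\rho\Big\}.$$ For $1\le k,\ell\le n$ let $$\widehat V^{(X,\nu)}_{k,\ell}=\varphi_\nu(X_k-X_\ell)-\frac1n\sum_{i=1}^n\varphi_\nu(X_i-X_\ell)-\frac1n\sum_{j=1}^n\varphi_\nu(X_k-X_j)+\frac1{n^2}\sum_{i,j=1}^n\varphi_\nu(X_i-X_j),$$ and define $\widehat V^{(Y,\nu)}_{k,\ell}$ in the same way from $Y_1,\dots,Y_n$. Set $\widehat{\operatorname{dCov}}{}_\nu^2(X,Y)=n^{-2}\sum_{k,\ell=1}^n\widehat V^{(X,\nu)}_{k,\ell}\widehat V^{(Y,\nu)}_{k,\ell}$ and, for a permutation $\Pi$ of $(1,\dots,n)$, $\widehat{\operatorname{dCov}}{}_\nu^2(X,Y,\Pi)=n^{-2}\sum_{k,\ell=1}^n\widehat V^{(X,\nu)}_{k,\ell}\widehat V^{(Y,\nu)}_{\Pi(k),\Pi(\ell)}$. Let $\Pi_1,\dots,\Pi_B$ be i.i.d. uniform random permutations of $(1,\dots,n)$, independent of the data. The test is $$\widehat\psi_{\nu,n}(\alpha)=\mathbf 1\Big\{\frac1B\sum_{b=1}^B\mathbf 1\big\{\widehat{\operatorname{dCov}}{}_\nu^2(X,Y,\Pi_b)<\widehat{\operatorname{dCov}}{}_\nu^2(X,Y)\big\}>1-\alpha\Big\},$$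 where the value $1$ means rejection of independence. The probability $\mathrm P$ is over the data and the permutations. "Absolute constant" means not depending on $n,B,\alpha,\beta,\nu$ or $\mathbb P^{X,Y}$. *)

theory Defs
  imports "HOL-Probability.Probability" "HOL-Combinatorics.Permutations"
begin

text \<open>
  The Hilbert space is the universe of a type of sort \<open>{real_inner, polish_space}\<close>: a real inner
  product space that is complete and second countable, where for metric spaces second countable
  means separable. Infinite dimension is not part of the sort.

  Sample indices range over \<open>{1..n}\<close>, and a sample is a function \<open>nat \<Rightarrow> 'a\<close> (or
  \<open>nat \<Rightarrow> 'a \<times> 'a\<close> for paired data).
\<close>

definition topological_support :: "'a::topological_space measure \<Rightarrow> 'a set" where
  "topological_support \<nu> = {x. \<forall>U. open U \<and> x \<in> U \<longrightarrow> emeasure \<nu> U > 0}"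

definition sym_full_measures :: "'a::{real_inner, polish_space} measure set" where
  "sym_full_measures = {\<nu>. sets \<nu> = sets borel \<and> prob_space \<nu> \<and>
     (\<forall>B\<in>sets borel. emeasure \<nu> B = emeasure \<nu> (uminus ` B)) \<and>
     topological_support \<nu> = UNIV}"

definition hchar :: "'a::{real_inner, polish_space} measure \<Rightarrow> 'a \<Rightarrow> complex" where
  "hchar \<nu> w = (CLINT z|\<nu>. iexp (w \<bullet> z))"

definition joint_char :: "('a::{real_inner, polish_space} \<times> 'a) measure \<Rightarrow> 'a \<Rightarrow> 'a \<Rightarrow> complex" where
  "joint_char P w1 w2 = (CLINT p|P. iexp (fst p \<bullet> w1 + snd p \<bullet> w2))"

definition local_alternatives ::
  "'a::{real_inner, polish_space} measure \<Rightarrow> real \<Rightarrow> ('a \<times> 'a) measure set" where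
  "local_alternatives \<nu> \<rho> = {P. sets P = sets borel \<and> prob_space P \<and>
     (LINT w|(\<nu> \<Otimes>\<^sub>M \<nu>). (cmod (joint_char P (fst w) (snd w)
        - hchar (distr P borel fst) (fst w) * hchar (distr P borel snd) (snd w)))\<^sup>2) \<ge> \<rho>}"

definition Vhat ::
  "'a::{real_inner, polish_space} measure \<Rightarrow> nat \<Rightarrow> (nat \<Rightarrow> 'a) \<Rightarrow> nat \<Rightarrow> nat \<Rightarrow> complex" where
  "Vhat \<nu> n x k l = hchar \<nu> (x k - x l)
     - 1 / of_nat n * (\<Sum>i=1..n. hchar \<nu> (x i - x l))
     - 1 / of_nat n * (\<Sum>j=1..n. hchar \<nu> (x k - x j))
     + 1 / (of_nat n)\<^sup>2 * (\<Sum>i=1..n. \<Sum>j=1..n. hchar \<nu> (x i - x j))"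

text \<open>
  The characteristic function of a symmetric measure is real-valued, so the two sums below are
  real numbers; \<open>Re\<close> only moves them to the type \<open>real\<close>, where they can be compared
  (see \<open>Vhat_real\<close>).
\<close>

definition dCov2 ::
  "'a::{real_inner, polish_space} measure \<Rightarrow> nat \<Rightarrow> (nat \<Rightarrow> 'a) \<Rightarrow> (nat \<Rightarrow> 'a) \<Rightarrow> real" where
  "dCov2 \<nu> n x y = Re (1 / (of_nat n)\<^sup>2 * (\<Sum>k=1..n. \<Sum>l=1..n. Vhat \<nu> n x k l * Vhat \<nu> n y k l))"

definition dCov2_perm ::
  "'a::{real_inner, polish_space} measure \<Rightarrow> nat \<Rightarrow> (nat \<Rightarrow> 'a) \<Rightarrow> (nat \<Rightarrow> 'a) \<Rightarrow> (nat \<Rightarrow> nat) \<Rightarrow> real" where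
  "dCov2_perm \<nu> n x y \<pi> =
     Re (1 / (of_nat n)\<^sup>2 * (\<Sum>k=1..n. \<Sum>l=1..n. Vhat \<nu> n x k l * Vhat \<nu> n y (\<pi> k) (\<pi> l)))"

text \<open>
  An outcome of the experiment is a pair of the data \<open>(X\<^sub>k, Y\<^sub>k)\<close>, \<open>k \<in> {1..n}\<close>, and
  the permutations \<open>\<Pi>\<^sub>b\<close>, \<open>b \<in> {1..B}\<close>.
\<close>

type_synonym 'a outcome = "(nat \<Rightarrow> 'a \<times> 'a) \<times> (nat \<Rightarrow> nat \<Rightarrow> nat)"

definition perm_test ::
  "'a::{real_inner, polish_space} measure \<Rightarrow> nat \<Rightarrow> nat \<Rightarrow> real \<Rightarrow> 'a outcome \<Rightarrow> nat" where
  "perm_test \<nu> n B \<alpha> \<omega> =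
     (let x = (\<lambda>k. fst (fst \<omega> k)); y = (\<lambda>k. snd (fst \<omega> k)); \<pi> = snd \<omega> in
      if 1 / real B * (\<Sum>b=1..B. of_bool (dCov2_perm \<nu> n x y (\<pi> b) < dCov2 \<nu> n x y)) > 1 - \<alpha>
      then 1 else 0)"

definition test_space ::
  "nat \<Rightarrow> nat \<Rightarrow> ('a::{real_inner, polish_space} \<times> 'a) measure \<Rightarrow> 'a outcome measure" where
  "test_space n B P = PiM {1..n} (\<lambda>_. P)
     \<Otimes>\<^sub>M PiM {1..B} (\<lambda>_. uniform_count_measure {\<pi>. \<pi> permutes {1..n}})"

text \<open>
  The suprema of probabilities are taken in \<open>ennreal\<close>, so that the supremum over an empty set of
  alternatives is \<open>0\<close>; the infimum is taken in \<open>ereal\<close>.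
\<close>

definition uniform_separation_rate ::
  "nat \<Rightarrow> nat \<Rightarrow> ('a::{real_inner, polish_space} measure \<Rightarrow> 'a outcome \<Rightarrow> nat) \<Rightarrow> real \<Rightarrow> ereal" where
  "uniform_separation_rate n B \<psi> \<beta> = Inf {ereal \<rho> | \<rho>. \<rho> > 0 \<and>
     (SUP \<nu>\<in>sym_full_measures. SUP P\<in>local_alternatives \<nu> \<rho>.
        emeasure (test_space n B P) {\<omega>\<in>space (test_space n B P). \<psi> \<nu> \<omega> = 0}) \<le> ennreal \<beta>}"

lemma hchar_sym_real:
  assumes "\<nu> \<in> sym_full_measures"
  shows "hchar \<nu> w \<in> \<real>"
proof -
  have sets [measurable_cong]: "sets \<nu> = sets borel" and
    sym: "\<And>B. B \<in> sets borel \<Longrightarrow> emeasure \<nu> B = emeasure \<nu> (uminus ` B)"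
    using assms by (auto simp: sym_full_measures_def)
  have sp: "space \<nu> = UNIV" using sets_eq_imp_space_eq[OF sets] by simp
  have d: "distr \<nu> borel uminus = \<nu>"
  proof (rule measure_eqI)
    fix A assume "A \<in> sets (distr \<nu> borel uminus)"
    then have A: "A \<in> sets borel" by simp
    have "uminus -` A = uminus ` A" by force
    then show "emeasure (distr \<nu> borel uminus) A = emeasure \<nu> A"
      using A sym[OF A] by (simp add: emeasure_distr sp)
  qed (simp add: sets)
  have "hchar \<nu> w = (CLINT z|distr \<nu> borel uminus. iexp (w \<bullet> z))"
    by (simp add: d hchar_def)
  also have "\<dots> = (CLINT z|\<nu>. iexp (w \<bullet> (- z)))"
    by (rule integral_distr) auto
  also have "\<dots> = (CLINT z|\<nu>. cnj (iexp (w \<bullet> z)))"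
    by (intro Bochner_Integration.integral_cong) (auto simp: exp_cnj)
  also have "\<dots> = cnj (hchar \<nu> w)"
    unfolding hchar_def by simp
  finally show ?thesis by (simp add: Reals_cnj_iff)
qed

lemma Vhat_real:
  assumes "\<nu> \<in> sym_full_measures"
  shows "Vhat \<nu> n x k l \<in> \<real>"
  unfolding Vhat_def
  by (intro Reals_add Reals_diff Reals_mult Reals_divide Reals_power sum_in_Reals
      hchar_sym_real[OF assms]) auto

text \<open>The outcomes on which the test accepts form an event, so its probability is meaningful.\<close>

lemma hchar_measurable:
  assumes "\<nu> \<in> sym_full_measures"
  shows "hchar \<nu> \<in> borel_measurable borel"
proof -
  have sets [measurable_cong]: "sets \<nu> = sets borel" and "prob_space \<nu>"
    using assms by (auto simp: sym_full_measures_def)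
  interpret prob_space \<nu> by fact
  have "(\<lambda>w. CLINT z|\<nu>. iexp (w \<bullet> z)) \<in> borel_measurable borel"
    by measurable
  then show ?thesis by (simp add: hchar_def[abs_def])
qed

lemma accept_event:
  assumes \<nu>: "\<nu> \<in> sym_full_measures" and P: "sets P = sets borel"
  shows "{\<omega>\<in>space (test_space n B P). perm_test \<nu> n B \<alpha> \<omega> = 0} \<in> sets (test_space n B P)"
proof -
  note [measurable] = hchar_measurable[OF \<nu>]
  note [measurable_cong] = P
  let ?S = "{\<pi>. \<pi> permutes {1..n}}" and ?D = "PiM {1..n} (\<lambda>_. P)"
  let ?U = "uniform_count_measure {\<pi>. \<pi> permutes {1..n}}"
  let ?M = "PiM {1..B} (\<lambda>_. ?U)"
  have fst_P[measurable]: "fst \<in> P \<rightarrow>\<^sub>M borel" and snd_P[measurable]: "snd \<in> P \<rightarrow>\<^sub>M borel"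
    unfolding measurable_cong_sets[OF P refl]
    by (auto intro!: borel_measurable_continuous_onI continuous_intros)
  have x[measurable]: "(\<lambda>d. fst (d k)) \<in> ?D \<rightarrow>\<^sub>M borel"
    and y[measurable]: "(\<lambda>d. snd (d k)) \<in> ?D \<rightarrow>\<^sub>M borel" if "k \<in> {1..n}" for k
    using that by measurable
  have Vx[measurable]: "(\<lambda>d. Vhat \<nu> n (\<lambda>k. fst (d k)) k l) \<in> borel_measurable ?D"
    if "k \<in> {1..n}" "l \<in> {1..n}" for k l
    unfolding Vhat_def using that by measurable
  have Vy[measurable]: "(\<lambda>d. Vhat \<nu> n (\<lambda>k. snd (d k)) k l) \<in> borel_measurable ?D"
    if "k \<in> {1..n}" "l \<in> {1..n}" for k l
    unfolding Vhat_def using that by measurable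
  have D[measurable]:
    "(\<lambda>d. dCov2 \<nu> n (\<lambda>k. fst (d k)) (\<lambda>k. snd (d k))) \<in> borel_measurable ?D"
    unfolding dCov2_def by measurable
  have Dp: "(\<lambda>d. dCov2_perm \<nu> n (\<lambda>k. fst (d k)) (\<lambda>k. snd (d k)) p) \<in> borel_measurable ?D"
    if "p \<in> ?S" for p
  proof -
    have "p k \<in> {1..n}" if "k \<in> {1..n}" for k
      using \<open>p \<in> ?S\<close> that permutes_in_image[of p "{1..n}" k] by auto
    then show ?thesis unfolding dCov2_perm_def
      by (intro borel_measurable_Re borel_measurable_times borel_measurable_sum Vx Vy
          borel_measurable_const measurable_compose[OF _ borel_measurable_Re]) auto
  qed
  have fin: "finite ?S" by (simp add: finite_permutations)
  have b: "(\<lambda>\<omega>. snd \<omega> b) \<in> ?D \<Otimes>\<^sub>M ?M \<rightarrow>\<^sub>M count_space ?S" if "b \<in> {1..B}" for b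
  proof -
    have "(\<lambda>\<omega>. snd \<omega> b) \<in> ?D \<Otimes>\<^sub>M ?M \<rightarrow>\<^sub>M ?U" using that by measurable
    then show ?thesis
      by (subst (asm) measurable_cong_sets[OF refl, of ?U "count_space ?S"])
        (auto simp: sets_uniform_count_measure)
  qed
  have Db: "(\<lambda>\<omega>. dCov2_perm \<nu> n (\<lambda>k. fst (fst \<omega> k)) (\<lambda>k. snd (fst \<omega> k)) (snd \<omega> b))
      \<in> borel_measurable (?D \<Otimes>\<^sub>M ?M)" if "b \<in> {1..B}" for b
  proof (rule measurable_compose_countable'[where I = ?S and g = "\<lambda>\<omega>. snd \<omega> b"
        and f = "\<lambda>p \<omega>. dCov2_perm \<nu> n (\<lambda>k. fst (fst \<omega> k)) (\<lambda>k. snd (fst \<omega> k)) p"])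
    show "(\<lambda>\<omega>. dCov2_perm \<nu> n (\<lambda>k. fst (fst \<omega> k)) (\<lambda>k. snd (fst \<omega> k)) p)
        \<in> borel_measurable (?D \<Otimes>\<^sub>M ?M)" if "p \<in> ?S" for p
      using measurable_compose[OF measurable_fst Dp[OF that]] by simp
  qed (use b that fin in \<open>auto intro: countable_finite\<close>)
  have D': "(\<lambda>\<omega>. dCov2 \<nu> n (\<lambda>k. fst (fst \<omega> k)) (\<lambda>k. snd (fst \<omega> k)))
      \<in> borel_measurable (?D \<Otimes>\<^sub>M ?M)"
    using measurable_compose[OF measurable_fst D] by simp
  have ob: "(\<lambda>\<omega>. of_bool (dCov2_perm \<nu> n (\<lambda>k. fst (fst \<omega> k)) (\<lambda>k. snd (fst \<omega> k)) (snd \<omega> b)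
        < dCov2 \<nu> n (\<lambda>k. fst (fst \<omega> k)) (\<lambda>k. snd (fst \<omega> k))) :: real)
      \<in> borel_measurable (?D \<Otimes>\<^sub>M ?M)" if "b \<in> {1..B}" for b
    using Db[OF that] D' unfolding of_bool_def by measurable
  have "(\<lambda>\<omega>. \<Sum>b=1..B. of_bool (dCov2_perm \<nu> n (\<lambda>k. fst (fst \<omega> k)) (\<lambda>k. snd (fst \<omega> k)) (snd \<omega> b)
        < dCov2 \<nu> n (\<lambda>k. fst (fst \<omega> k)) (\<lambda>k. snd (fst \<omega> k))) :: real)
      \<in> borel_measurable (?D \<Otimes>\<^sub>M ?M)"
    by (intro borel_measurable_sum ob)
  then show ?thesis
    unfolding test_space_def perm_test_def Let_def by measurable
qed

end

theory Submission
  imports Defs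
begin

text \<open>
  The statistic is an \<open>L\<^sup>2\<close> norm. Write \<open>u\<^sub>k(w) = exp (i \<langle>x\<^sub>k, w\<rangle>)\<close> and \<open>v\<^sub>k(w) = exp (i \<langle>y\<^sub>k, w\<rangle>)\<close>.
  Since \<open>\<phi>\<^sub>\<nu>(x\<^sub>k - x\<^sub>l)\<close> is the integral of \<open>u\<^sub>k cnj u\<^sub>l\<close> against \<open>\<nu>\<close>, double centring of the
  kernel is centring of the \<open>u\<^sub>k\<close>, and the squared sample distance covariance is
  \<open>\<integral>\<integral> |c(w\<^sub>1, w\<^sub>2)|\<^sup>2 d\<nu> d\<nu>\<close>, where \<open>c(w\<^sub>1, w\<^sub>2)\<close> is the sample covariance of the bounded
  sequences \<open>u\<^sub>k(w\<^sub>1)\<close> and \<open>v\<^sub>k(w\<^sub>2)\<close> (\<open>dCov2_eq_integral\<close>). The permuted statistic is the same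
  functional of the sample \<open>(x\<^sub>k, y\<^bsub>\<pi>(k)\<^esub>)\<close>. This gives three facts.

  \<^item> The expectation of \<open>c\<close> is \<open>1 - 1/n\<close> times \<open>\<phi>\<^bsub>X,Y\<^esub> - \<phi>\<^sub>X \<phi>\<^sub>Y\<close>, so by Jensen's inequality the mean of
    the statistic is at least \<open>(1 - 1/n)\<^sup>2 \<rho> \<ge> \<rho>/2\<close> on the alternative
    (\<open>expectation_dCov2_ge\<close>).
  \<^item> For fixed data, the mean of the permuted statistic over all permutations is at most \<open>32/n\<close>
    (\<open>mean_dCov2_permutations\<close>).
  \<^item> Replacing one observation, or composing the permutation with a transposition, changes the
    statistic by at most \<open>32/n\<close> (\<open>dCov2_change_one\<close>, \<open>dCov2_swap\<close>).

  By bounded differences, both in the data (\<open>McDiarmid\<close>) and in the permutation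
  (\<open>permutation_tail_bound\<close>), deviations of size \<open>t\<close> have probability at most \<open>exp (- C n t\<^sup>2)\<close>.
  Hence, when \<open>\<rho>\<close> is a large multiple of \<open>n powr (-1/2) * (ln (1/\<alpha>) + ln (1/\<beta>))\<close>, the statistic is at
  least \<open>\<rho>/4\<close> except with probability \<open>\<beta>/2\<close>, and in that case at most a fraction \<open>\<alpha>/2\<close> of all
  permutations reaches it. The test then accepts only if a fraction \<open>\<alpha>\<close> of the \<open>B\<close> random
  permutations reaches it, which has probability at most \<open>exp (- B \<alpha>\<^sup>2 / 2) \<le> \<beta>/6\<close> by bounded differences
  once more (\<open>accept_probability_given_data\<close>). These bounds are combined in \<open>type_II_error_le\<close>.
\<close>

section \<open>Concentration under bounded differences\<close>

lemma Hoeffding_lemma_finite: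
  fixes X :: "'b \<Rightarrow> real"
  assumes A: "finite A" "A \<noteq> {}" and X: "\<And>a. a \<in> A \<Longrightarrow> X a \<in> {lo..hi}" and l: "l > 0"
  shows "(\<Sum>a\<in>A. exp (l * (X a - (\<Sum>a\<in>A. X a) / card A))) \<le> card A * exp (l\<^sup>2 * (hi - lo)\<^sup>2 / 8)"
proof -
  let ?p = "measure_pmf (pmf_of_set A)"
  interpret interval_bounded_random_variable ?p X lo hi
    by unfold_locales (use A X in \<open>auto simp: AE_measure_pmf_iff\<close>)
  have pos: "card A > 0" using A by (simp add: card_gt_0_iff)
  have E: "integral\<^sup>L (measure_pmf (pmf_of_set A)) X = (\<Sum>a\<in>A. X a) / card A"
    by (rule integral_pmf_of_set[OF A(2,1)])
  have "ennreal ((\<Sum>a\<in>A. exp (l * (X a - (\<Sum>a\<in>A. X a) / card A))) / card A)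
      = (\<integral>\<^sup>+x. ennreal (exp (l * (X x - integral\<^sup>L ?p X))) \<partial>?p)"
    using A pos unfolding E nn_integral_pmf_of_set[OF A(2,1)]
    by (simp add: sum_nonneg divide_ennreal ennreal_of_nat_eq_real_of_nat)
  also have "\<dots> \<le> ennreal (exp (l\<^sup>2 * (hi - lo)\<^sup>2 / 8))"
    by (rule Hoeffdings_lemma_nn_integral[OF l])
  finally have "(\<Sum>a\<in>A. exp (l * (X a - (\<Sum>a\<in>A. X a) / card A))) / card A \<le> exp (l\<^sup>2 * (hi - lo)\<^sup>2 / 8)"
    by simp
  then show ?thesis using pos by (simp add: field_simps)
qed

text \<open>
  Induction on the number of coordinates. Integrating out the coordinate \<open>i\<close> gives a function \<open>g\<close> of the
  remaining ones with the same mean and again with differences bounded by \<open>c\<close>. For fixed remaining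
  coordinates, \<open>f - g\<close> is centred and takes values in an interval of length \<open>c\<close>, so Hoeffding's lemma
  bounds its exponential moment.
\<close>

lemma nn_integral_exp_bounded_differences:
  fixes f :: "('i \<Rightarrow> 'b) \<Rightarrow> real" and c :: real
  assumes M: "prob_space M" and I: "finite I"
    and f: "f \<in> borel_measurable (PiM I (\<lambda>_. M))"
    and bnd: "\<And>x. x \<in> space (PiM I (\<lambda>_. M)) \<Longrightarrow> \<bar>f x\<bar> \<le> K"
    and diff: "\<And>x i y. x \<in> space (PiM I (\<lambda>_. M)) \<Longrightarrow> i \<in> I \<Longrightarrow> y \<in> space M \<Longrightarrow> f (x(i := y)) \<le> f x + c"
    and l: "l > 0"
  shows "(\<integral>\<^sup>+x. ennreal (exp (l * (f x - (LINT x|PiM I (\<lambda>_. M). f x)))) \<partial>PiM I (\<lambda>_. M))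
    \<le> ennreal (exp (l\<^sup>2 * c\<^sup>2 * card I / 8))"
  using I f bnd diff
proof (induction I arbitrary: f rule: finite_induct)
  case empty
  then show ?case by (simp add: PiM_empty nn_integral_count_space_finite lebesgue_integral_count_space_finite)
next
  case (insert i I)
  interpret M: prob_space M by fact
  interpret product_prob_space "\<lambda>_. M" by unfold_locales
  interpret PI: prob_space "PiM I (\<lambda>_. M)" by (intro prob_space_PiM M)
  interpret QI: prob_space "PiM (insert i I) (\<lambda>_. M)" by (intro prob_space_PiM M)
  note [measurable] = insert.prems(1)
  have upd[measurable]: "(\<lambda>(x, y). x(i := y)) \<in> PiM I (\<lambda>_. M) \<Otimes>\<^sub>M M \<rightarrow>\<^sub>M PiM (insert i I) (\<lambda>_. M)"
    using measurable_add_dim[of i I "\<lambda>_. M"] by simp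
  have upd_space: "x(i := y) \<in> space (PiM (insert i I) (\<lambda>_. M))"
    if "x \<in> space (PiM I (\<lambda>_. M))" "y \<in> space M" for x y
    using that by (auto simp: space_PiM PiE_def extensional_def Pi_def)
  have f2[measurable]: "(\<lambda>(x, y). f (x(i := y))) \<in> borel_measurable (PiM I (\<lambda>_. M) \<Otimes>\<^sub>M M)"
    using measurable_compose[OF upd insert.prems(1)] by (simp add: case_prod_beta')
  have fx[measurable]: "(\<lambda>y. f (x(i := y))) \<in> borel_measurable M"
    if "x \<in> space (PiM I (\<lambda>_. M))" for x
    using measurable_compose[OF measurable_Pair1'[OF that] f2] by simp
  define g where "g = (\<lambda>x. LINT y|M. f (x(i := y)))"
  have g[measurable]: "g \<in> borel_measurable (PiM I (\<lambda>_. M))"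
    unfolding g_def by measurable
  have intM: "integrable M (\<lambda>y. f (x(i := y)))" if "x \<in> space (PiM I (\<lambda>_. M))" for x
    by (rule M.integrable_const_bound[where B = K])
      (use insert.prems(2) upd_space that in \<open>auto intro!: AE_I2\<close>)
  have intf: "integrable (PiM (insert i I) (\<lambda>_. M)) f"
    by (rule QI.integrable_const_bound[where B = K]) (use insert.prems(2) in \<open>auto intro!: AE_I2\<close>)
  have Eg: "(LINT x|PiM (insert i I) (\<lambda>_. M). f x) = (LINT x|PiM I (\<lambda>_. M). g x)" (is "?E = _")
    unfolding g_def by (rule product_integral_insert[OF insert.hyps intf])
  have gb: "\<bar>g x\<bar> \<le> K" if "x \<in> space (PiM I (\<lambda>_. M))" for x
  proof -
    have "\<bar>g x\<bar> \<le> (LINT y|M. \<bar>f (x(i := y))\<bar>)" unfolding g_def by (rule integral_abs_bound)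
    also have "\<dots> \<le> (LINT y|M. K)"
      by (rule integral_mono) (use intM that insert.prems(2) upd_space in auto)
    finally show ?thesis by (simp add: M.prob_space)
  qed
  have gd: "g (x(j := z)) \<le> g x + c"
    if x: "x \<in> space (PiM I (\<lambda>_. M))" and j: "j \<in> I" and z: "z \<in> space M" for x j z
  proof -
    have xz: "x(j := z) \<in> space (PiM I (\<lambda>_. M))"
      using x j z by (auto simp: space_PiM PiE_def extensional_def Pi_def)
    have ji: "j \<noteq> i" using j insert.hyps by auto
    have "g (x(j := z)) \<le> (LINT y|M. f (x(i := y)) + c)" unfolding g_def
    proof (rule integral_mono)
      show "f (x(j := z, i := y)) \<le> f (x(i := y)) + c" if "y \<in> space M" for y
        unfolding fun_upd_twist[OF ji]
        by (rule insert.prems(3)[OF upd_space[OF x that]]) (use j z in auto)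
    qed (use intM x xz in auto)
    then show ?thesis using intM[OF x] by (simp add: g_def M.prob_space)
  qed
  have step: "(\<integral>\<^sup>+y. ennreal (exp (l * (f (x(i := y)) - g x))) \<partial>M) \<le> ennreal (exp (l\<^sup>2 * c\<^sup>2 / 8))"
    if x: "x \<in> space (PiM I (\<lambda>_. M))" for x
  proof -
    \<comment> \<open>A one-sided difference bound confines the values to \<open>[a, a + c]\<close> with \<open>a\<close> their infimum.\<close>
    define a where "a = (INF y\<in>space M. f (x(i := y)))"
    have "- K \<le> f (x(i := y))" if "y \<in> space M" for y
      using insert.prems(2)[OF upd_space[OF x that]] by linarith
    then have bdd: "bdd_below ((\<lambda>y. f (x(i := y))) ` space M)"
      by (rule bdd_belowI2)
    have lo: "a \<le> f (x(i := y))" if "y \<in> space M" for y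
      unfolding a_def by (rule cINF_lower[OF bdd that])
    have hi: "f (x(i := y)) \<le> a + c" if y: "y \<in> space M" for y
    proof -
      have "f (x(i := y)) - c \<le> f (x(i := y'))" if "y' \<in> space M" for y'
        using insert.prems(3)[OF upd_space[OF x that], of i y] y by (simp del: fun_upd_apply)
      then have "f (x(i := y)) - c \<le> a"
        unfolding a_def by (intro cINF_greatest) (use M.not_empty in auto)
      then show ?thesis by simp
    qed
    interpret interval_bounded_random_variable M "\<lambda>y. f (x(i := y))" a "a + c"
      by unfold_locales (use x lo hi in \<open>auto intro!: AE_I2\<close>)
    show ?thesis using Hoeffdings_lemma_nn_integral[OF l] by (simp add: g_def)
  qed
  have "(\<integral>\<^sup>+x. ennreal (exp (l * (f x - ?E))) \<partial>PiM (insert i I) (\<lambda>_. M))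
      = (\<integral>\<^sup>+x. \<integral>\<^sup>+y. ennreal (exp (l * (f (x(i := y)) - ?E))) \<partial>M \<partial>PiM I (\<lambda>_. M))"
    by (rule product_nn_integral_insert[OF insert.hyps]) measurable
  also have "\<dots> = (\<integral>\<^sup>+x. ennreal (exp (l * (g x - ?E))) *
      (\<integral>\<^sup>+y. ennreal (exp (l * (f (x(i := y)) - g x))) \<partial>M) \<partial>PiM I (\<lambda>_. M))"
    by (intro nn_integral_cong, subst nn_integral_cmult[symmetric])
      (auto simp: ennreal_mult[symmetric] mult_exp_exp algebra_simps)
  also have "\<dots> \<le> (\<integral>\<^sup>+x. ennreal (exp (l * (g x - ?E))) * ennreal (exp (l\<^sup>2 * c\<^sup>2 / 8)) \<partial>PiM I (\<lambda>_. M))"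
    by (intro nn_integral_mono mult_left_mono step) auto
  also have "\<dots> = (\<integral>\<^sup>+x. ennreal (exp (l * (g x - ?E))) \<partial>PiM I (\<lambda>_. M)) * ennreal (exp (l\<^sup>2 * c\<^sup>2 / 8))"
    by (rule nn_integral_multc) measurable
  also have "\<dots> \<le> ennreal (exp (l\<^sup>2 * c\<^sup>2 * card I / 8)) * ennreal (exp (l\<^sup>2 * c\<^sup>2 / 8))"
    unfolding Eg by (intro mult_right_mono insert.IH g gb gd) auto
  also have "\<dots> = ennreal (exp (l\<^sup>2 * c\<^sup>2 * card (insert i I) / 8))"
    using insert.hyps by (simp add: ennreal_mult[symmetric] mult_exp_exp field_simps)
  finally show ?case .
qed

text \<open>
  The Chernoff bound for the exponential moment above. It serves twice: for the sample, and, with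
  \<open>c = 1\<close>, in place of Hoeffding's inequality for the random permutations.
\<close>

lemma McDiarmid:
  fixes f :: "('i \<Rightarrow> 'b) \<Rightarrow> real" and c :: real
  assumes M: "prob_space M" and I: "finite I" "I \<noteq> {}"
    and f: "f \<in> borel_measurable (PiM I (\<lambda>_. M))"
    and bnd: "\<And>x. x \<in> space (PiM I (\<lambda>_. M)) \<Longrightarrow> \<bar>f x\<bar> \<le> K"
    and diff: "\<And>x i y. x \<in> space (PiM I (\<lambda>_. M)) \<Longrightarrow> i \<in> I \<Longrightarrow> y \<in> space M \<Longrightarrow> f (x(i := y)) \<le> f x + c"
    and c: "c > 0" and t: "t > 0"
  shows "emeasure (PiM I (\<lambda>_. M)) {x \<in> space (PiM I (\<lambda>_. M)). f x \<ge> (LINT x|PiM I (\<lambda>_. M). f x) + t}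
    \<le> ennreal (exp (- 2 * t\<^sup>2 / (card I * c\<^sup>2)))" (is "emeasure ?P {x \<in> _. _ \<ge> ?E + t} \<le> _")
proof -
  have n: "card I > 0" using I by (simp add: card_gt_0_iff)
  \<comment> \<open>The minimiser of the exponent \<open>- l t + l\<^sup>2 c\<^sup>2 card I / 8\<close>.\<close>
  define l where "l = 4 * t / (card I * c\<^sup>2)"
  have l: "l > 0" using n c t by (simp add: l_def)
  note [measurable] = f
  have "emeasure ?P {x \<in> space ?P. f x - ?E \<ge> t}
      \<le> ennreal (exp (- (l * t))) * (\<integral>\<^sup>+x. ennreal (exp (l * (f x - ?E))) * indicator (space ?P) x \<partial>?P)"
    using Chernoff_ineq_nn_integral_ge[OF l, of "space ?P" ?P "\<lambda>x. f x - ?E" t] by simp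
  also have "(\<integral>\<^sup>+x. ennreal (exp (l * (f x - ?E))) * indicator (space ?P) x \<partial>?P)
      = (\<integral>\<^sup>+x. ennreal (exp (l * (f x - ?E))) \<partial>?P)"
    by (intro nn_integral_cong) auto
  also have "ennreal (exp (- (l * t))) * \<dots> \<le> ennreal (exp (- (l * t))) * ennreal (exp (l\<^sup>2 * c\<^sup>2 * card I / 8))"
    by (intro mult_left_mono nn_integral_exp_bounded_differences[OF M I(1) f bnd diff l]) auto
  also have "\<dots> = ennreal (exp (- 2 * t\<^sup>2 / (card I * c\<^sup>2)))"
  proof -
    have "- (l * t) + l\<^sup>2 * c\<^sup>2 * card I / 8 = - 2 * t\<^sup>2 / (card I * c\<^sup>2)"
      using n c by (simp add: l_def field_simps power2_eq_square)
    then show ?thesis by (simp add: ennreal_mult[symmetric] mult_exp_exp)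
  qed
  finally show ?thesis by (simp add: algebra_simps)
qed

text \<open>
  The counterpart for a uniform random permutation. A permutation of \<open>insert a S\<close> is uniquely
  \<open>transpose a b \<circ> q\<close> with \<open>q\<close> a permutation of \<open>S\<close>, so that \<open>b\<close> plays the role of one more
  coordinate. The conditional mean \<open>m b\<close> given \<open>b\<close> differs from \<open>m a\<close> by at most \<open>c\<close>, because pairing
  \<open>transpose a b \<circ> q\<close> with \<open>q\<close> costs one transposition. Comparison with the single pivot \<open>m a\<close> gives
  an interval of length \<open>2 c\<close>, which is the reason for the constant 2 in place of 8.
\<close>

lemma sum_exp_permutations:
  fixes f :: "('i \<Rightarrow> 'i) \<Rightarrow> real" and c :: real
  assumes S: "finite S"
    and diff: "\<And>p i j. p permutes S \<Longrightarrow> i \<in> S \<Longrightarrow> j \<in> S \<Longrightarrow> \<bar>f (Transposition.transpose i j \<circ> p) - f p\<bar> \<le> c"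
    and l: "l > 0"
  shows "(\<Sum>p | p permutes S. exp (l * (f p - (\<Sum>p | p permutes S. f p) / fact (card S))))
    \<le> fact (card S) * exp (l\<^sup>2 * c\<^sup>2 * card S / 2)"
  using S diff
proof (induction S arbitrary: f rule: finite_induct)
  case empty
  then show ?case by simp
next
  case (insert a S)
  let ?n = "card (insert a S)" and ?k = "fact (card S) :: real"
  let ?P = "{p. p permutes S}"
  have cardP: "real (card ?P) = ?k" using insert.hyps by (simp add: card_permutations)
  define m where "m = (\<lambda>b. (\<Sum>q\<in>?P. f (Transposition.transpose a b \<circ> q)) / ?k)"
  have sub: "q permutes insert a S" if "q permutes S" for q
    using that by (rule permutes_subset) auto
  have mean: "(\<Sum>p | p permutes insert a S. f p) / fact ?n = (\<Sum>b\<in>insert a S. m b) / ?n" (is "?m = _")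
    unfolding sum_over_permutations_insert[OF insert.hyps] m_def sum_divide_distrib[symmetric]
    using insert.hyps by (simp add: field_simps)
  have near: "m b \<in> {m a - c..m a + c}" if b: "b \<in> insert a S" for b
  proof -
    have "\<bar>\<Sum>q\<in>?P. f (Transposition.transpose a b \<circ> q) - f q\<bar> \<le> (\<Sum>q\<in>?P. \<bar>f (Transposition.transpose a b \<circ> q) - f q\<bar>)"
      by (rule sum_abs)
    also have "\<dots> \<le> (\<Sum>q\<in>?P. c)"
      by (intro sum_mono insert.prems[OF sub _ b]) auto
    finally have "\<bar>\<Sum>q\<in>?P. f (Transposition.transpose a b \<circ> q) - f q\<bar> \<le> ?k * c" using cardP by simp
    then have "\<bar>\<Sum>q\<in>?P. f (Transposition.transpose a b \<circ> q) - f q\<bar> / ?k \<le> c"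
      by (simp only: pos_divide_le_eq[OF fact_gt_zero] mult.commute)
    moreover have "m b - m a = (\<Sum>q\<in>?P. f (Transposition.transpose a b \<circ> q) - f q) / ?k"
      by (simp add: m_def sum_subtractf diff_divide_distrib)
    ultimately have "\<bar>m b - m a\<bar> \<le> c" by simp
    then show ?thesis by auto
  qed
  have IH: "(\<Sum>q\<in>?P. exp (l * (f (Transposition.transpose a b \<circ> q) - m b))) \<le> ?k * exp (l\<^sup>2 * c\<^sup>2 * card S / 2)"
    if b: "b \<in> insert a S" for b
    unfolding m_def
  proof (rule insert.IH)
    fix p i j assume p: "p permutes S" and ij: "i \<in> S" "j \<in> S"
    \<comment> \<open>Moving the transposition to the left of \<open>transpose a b\<close> conjugates it into another one.\<close>
    have eq: "Transposition.transpose a b \<circ> (Transposition.transpose i j \<circ> p)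
        = Transposition.transpose (Transposition.transpose a b i) (Transposition.transpose a b j) \<circ> (Transposition.transpose a b \<circ> p)"
      by (auto simp: fun_eq_iff Transposition.transpose_def)
    have tb: "Transposition.transpose a b permutes insert a S" by (rule permutes_swap_id) (use b in auto)
    show "\<bar>f (Transposition.transpose a b \<circ> (Transposition.transpose i j \<circ> p)) - f (Transposition.transpose a b \<circ> p)\<bar> \<le> c"
      unfolding eq
    proof (rule insert.prems[OF permutes_compose[OF sub[OF p] tb]])
      show "Transposition.transpose a b i \<in> insert a S" "Transposition.transpose a b j \<in> insert a S"
        unfolding permutes_in_image[OF tb] using ij by auto
    qed
  qed
  have "(\<Sum>p | p permutes insert a S. exp (l * (f p - ?m)))
      = (\<Sum>b\<in>insert a S. exp (l * (m b - ?m)) * (\<Sum>q\<in>?P. exp (l * (f (Transposition.transpose a b \<circ> q) - m b))))"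
    unfolding sum_over_permutations_insert[OF insert.hyps] sum_distrib_left
    by (intro sum.cong refl) (simp add: mult_exp_exp algebra_simps)
  also have "\<dots> \<le> (\<Sum>b\<in>insert a S. exp (l * (m b - ?m)) * (?k * exp (l\<^sup>2 * c\<^sup>2 * card S / 2)))"
    by (intro sum_mono mult_left_mono IH) auto
  also have "\<dots> = (\<Sum>b\<in>insert a S. exp (l * (m b - ?m))) * (?k * exp (l\<^sup>2 * c\<^sup>2 * card S / 2))"
    by (simp add: sum_distrib_right)
  also have "\<dots> \<le> (?n * exp (l\<^sup>2 * ((m a + c) - (m a - c))\<^sup>2 / 8)) * (?k * exp (l\<^sup>2 * c\<^sup>2 * card S / 2))"
    unfolding mean
    by (intro mult_right_mono Hoeffding_lemma_finite[OF _ _ _ l]) (use insert.hyps near in auto)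
  also have "\<dots> = fact ?n * exp (l\<^sup>2 * c\<^sup>2 * ?n / 2)"
  proof -
    have "l\<^sup>2 * ((m a + c) - (m a - c))\<^sup>2 / 8 + l\<^sup>2 * c\<^sup>2 * card S / 2 = l\<^sup>2 * c\<^sup>2 * ?n / 2"
      using insert.hyps by (simp add: field_simps power2_eq_square)
    then have "exp (l\<^sup>2 * ((m a + c) - (m a - c))\<^sup>2 / 8) * exp (l\<^sup>2 * c\<^sup>2 * card S / 2) = exp (l\<^sup>2 * c\<^sup>2 * ?n / 2)"
      by (simp only: mult_exp_exp)
    moreover have "?n * ?k = fact ?n" using insert.hyps by simp
    moreover have "(x * y) * (z * w) = (x * z) * (y * w)" for x y z w :: real by simp
    ultimately show ?thesis by metis
  qed
  finally show ?case .
qed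

lemma permutation_tail_bound:
  fixes f :: "('i \<Rightarrow> 'i) \<Rightarrow> real" and c :: real
  assumes S: "finite S" "S \<noteq> {}"
    and diff: "\<And>p i j. p permutes S \<Longrightarrow> i \<in> S \<Longrightarrow> j \<in> S \<Longrightarrow> \<bar>f (Transposition.transpose i j \<circ> p) - f p\<bar> \<le> c"
    and c: "c > 0" and t: "t > 0"
  shows "real (card {p. p permutes S \<and> f p \<ge> (\<Sum>p | p permutes S. f p) / fact (card S) + t}) / fact (card S)
    \<le> exp (- t\<^sup>2 / (2 * card S * c\<^sup>2))"
proof -
  let ?m = "(\<Sum>p | p permutes S. f p) / fact (card S)"
  let ?A = "{p. p permutes S \<and> f p \<ge> ?m + t}"
  have n: "card S > 0" using S by (simp add: card_gt_0_iff)
  define l where "l = t / (card S * c\<^sup>2)"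
  have l: "l > 0" using n c t by (simp add: l_def)
  have fin: "finite {p. p permutes S}" using S by (simp add: finite_permutations)
  have "card ?A * exp (l * t) = (\<Sum>p\<in>?A. exp (l * t))" by simp
  also have "\<dots> \<le> (\<Sum>p\<in>?A. exp (l * (f p - ?m)))"
    by (rule sum_mono) (use l in auto)
  also have "\<dots> \<le> (\<Sum>p | p permutes S. exp (l * (f p - ?m)))"
    by (rule sum_mono2) (use fin in auto)
  also have "\<dots> \<le> fact (card S) * exp (l\<^sup>2 * c\<^sup>2 * card S / 2)"
    by (rule sum_exp_permutations[OF S(1) diff l])
  finally have "card ?A / fact (card S) \<le> exp (l\<^sup>2 * c\<^sup>2 * card S / 2) / exp (l * t)"
    by (simp add: field_simps)
  also have "\<dots> = exp (- t\<^sup>2 / (2 * card S * c\<^sup>2))"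
  proof -
    have "l\<^sup>2 * c\<^sup>2 * card S / 2 - l * t = - t\<^sup>2 / (2 * card S * c\<^sup>2)"
      using n c by (simp add: l_def field_simps power2_eq_square)
    then show ?thesis by (simp flip: exp_diff)
  qed
  finally show ?thesis .
qed

section \<open>Sample covariances of bounded complex sequences\<close>

definition sample_cov :: "nat \<Rightarrow> (nat \<Rightarrow> complex) \<Rightarrow> (nat \<Rightarrow> complex) \<Rightarrow> complex" where
  "sample_cov n u v = (\<Sum>k=1..n. u k * v k) / of_nat n
     - ((\<Sum>k=1..n. u k) / of_nat n) * ((\<Sum>k=1..n. v k) / of_nat n)"

lemma sum_centred:
  fixes u :: "nat \<Rightarrow> complex"
  assumes "n > 0"
  shows "(\<Sum>k=1..n. u k - (\<Sum>k=1..n. u k) / of_nat n) = 0"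
  using assms by (simp add: sum_subtractf)

lemma sample_cov_centred:
  assumes "n > 0"
  shows "sample_cov n u v = (\<Sum>k=1..n. (u k - (\<Sum>k=1..n. u k) / of_nat n) *
    (v k - (\<Sum>k=1..n. v k) / of_nat n)) / of_nat n"
  using assms
  by (simp add: sample_cov_def algebra_simps sum.distrib sum_subtractf diff_divide_distrib
      add_divide_distrib sum_divide_distrib[symmetric] sum_distrib_left[symmetric] sum_distrib_right[symmetric])

lemma norm_mean_le:
  fixes u :: "nat \<Rightarrow> complex"
  assumes "\<And>k. k \<in> {1..n} \<Longrightarrow> cmod (u k) \<le> K" and K: "0 \<le> K"
  shows "cmod ((\<Sum>k=1..n. u k) / of_nat n) \<le> K"
proof (cases "n = 0")
  case False
  have "cmod (\<Sum>k=1..n. u k) \<le> (\<Sum>k=1..n. K)"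
    by (rule sum_norm_le) (use assms in auto)
  then show ?thesis using False by (simp add: norm_divide field_simps)
qed (use K in simp)

lemma norm_sample_cov_le:
  assumes "\<And>k. k \<in> {1..n} \<Longrightarrow> cmod (u k) \<le> 1" "\<And>k. k \<in> {1..n} \<Longrightarrow> cmod (v k) \<le> 1"
  shows "cmod (sample_cov n u v) \<le> 2"
proof -
  have "cmod ((\<Sum>k=1..n. u k * v k) / of_nat n) \<le> 1"
    by (rule norm_mean_le) (use assms in \<open>auto simp: norm_mult intro!: mult_le_one\<close>)
  moreover have "cmod (((\<Sum>k=1..n. u k) / of_nat n) * ((\<Sum>k=1..n. v k) / of_nat n)) \<le> 1"
    unfolding norm_mult by (intro mult_le_one norm_mean_le norm_ge_zero) (use assms in auto)
  ultimately show ?thesis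
    unfolding sample_cov_def by (intro order.trans[OF norm_triangle_ineq4]) simp
qed

lemma norm_mult_diff_le:
  fixes a b a' b' :: complex
  assumes "cmod a \<le> 1" "cmod b' \<le> 1"
  shows "cmod (a' * b' - a * b) \<le> cmod (a' - a) + cmod (b' - b)"
proof -
  have "a' * b' - a * b = (a' - a) * b' + a * (b' - b)" by (simp add: algebra_simps)
  also have "cmod \<dots> \<le> cmod (a' - a) * cmod b' + cmod a * cmod (b' - b)"
    by (metis norm_mult norm_triangle_ineq)
  also have "\<dots> \<le> cmod (a' - a) * 1 + 1 * cmod (b' - b)"
    by (intro add_mono mult_mono) (use assms in auto)
  finally show ?thesis by simp
qed

lemma sample_cov_Lipschitz:
  assumes "\<And>k. k \<in> {1..n} \<Longrightarrow> cmod (u k) \<le> 1" "\<And>k. k \<in> {1..n} \<Longrightarrow> cmod (v k) \<le> 1"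
    and "\<And>k. k \<in> {1..n} \<Longrightarrow> cmod (u' k) \<le> 1" "\<And>k. k \<in> {1..n} \<Longrightarrow> cmod (v' k) \<le> 1"
  shows "cmod (sample_cov n u' v' - sample_cov n u v)
    \<le> 2 * ((\<Sum>k=1..n. cmod (u' k - u k)) + (\<Sum>k=1..n. cmod (v' k - v k))) / n"
proof -
  let ?m = "\<lambda>u. (\<Sum>k=1..n. u k) / of_nat n :: complex"
  let ?d = "\<lambda>u' u. (\<Sum>k=1..n. cmod (u' k - u k)) / n"
  have m: "cmod (?m u' - ?m u) \<le> ?d u' u" for u u' :: "nat \<Rightarrow> complex"
    unfolding diff_divide_distrib[symmetric] sum_subtractf[symmetric] norm_divide norm_of_nat
    by (intro divide_right_mono norm_sum) auto
  have "?d (\<lambda>k. u' k * v' k) (\<lambda>k. u k * v k) \<le> ?d u' u + ?d v' v"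
    unfolding add_divide_distrib[symmetric] sum.distrib[symmetric]
    by (intro divide_right_mono sum_mono norm_mult_diff_le) (use assms in auto)
  then have A: "cmod (?m (\<lambda>k. u' k * v' k) - ?m (\<lambda>k. u k * v k)) \<le> ?d u' u + ?d v' v"
    using m[of "\<lambda>k. u' k * v' k" "\<lambda>k. u k * v k"] by linarith
  have "cmod (?m u' * ?m v' - ?m u * ?m v) \<le> cmod (?m u' - ?m u) + cmod (?m v' - ?m v)"
    by (intro norm_mult_diff_le norm_mean_le) (use assms in auto)
  then have B: "cmod (?m u' * ?m v' - ?m u * ?m v) \<le> ?d u' u + ?d v' v"
    using m[of u' u] m[of v' v] by linarith
  have eq: "sample_cov n u' v' - sample_cov n u v
      = (?m (\<lambda>k. u' k * v' k) - ?m (\<lambda>k. u k * v k)) - (?m u' * ?m v' - ?m u * ?m v)"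
    by (simp add: sample_cov_def algebra_simps)
  have "cmod (sample_cov n u' v' - sample_cov n u v) \<le> (?d u' u + ?d v' v) + (?d u' u + ?d v' v)"
    unfolding eq by (rule order.trans[OF norm_triangle_ineq4 add_mono[OF A B]])
  then show ?thesis by (simp add: add_divide_distrib distrib_left)
qed

text \<open>
  The distance 4 is what both kinds of perturbation need: replacing one pair moves one term of each
  sequence by at most 2, and a transposition moves two terms of one sequence by at most 2.
\<close>

lemma sample_cov_sq_stable:
  assumes "\<And>k. k \<in> {1..n} \<Longrightarrow> cmod (u k) \<le> 1" "\<And>k. k \<in> {1..n} \<Longrightarrow> cmod (v k) \<le> 1"
    and "\<And>k. k \<in> {1..n} \<Longrightarrow> cmod (u' k) \<le> 1" "\<And>k. k \<in> {1..n} \<Longrightarrow> cmod (v' k) \<le> 1"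
    and d: "(\<Sum>k=1..n. cmod (u' k - u k)) + (\<Sum>k=1..n. cmod (v' k - v k)) \<le> 4"
  shows "(cmod (sample_cov n u' v'))\<^sup>2 \<le> (cmod (sample_cov n u v))\<^sup>2 + 32 / n"
proof -
  let ?a = "cmod (sample_cov n u' v')" and ?b = "cmod (sample_cov n u v)"
  have "?a - ?b \<le> cmod (sample_cov n u' v' - sample_cov n u v)" by (rule norm_triangle_ineq2)
  also have "\<dots> \<le> 2 * ((\<Sum>k=1..n. cmod (u' k - u k)) + (\<Sum>k=1..n. cmod (v' k - v k))) / n"
    by (rule sample_cov_Lipschitz) (use assms in auto)
  also have "\<dots> \<le> 2 * 4 / n"
    using d by (intro divide_right_mono mult_left_mono) auto
  finally have ab: "?a - ?b \<le> 8 / n" by simp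
  have s: "?a + ?b \<le> 4"
    using norm_sample_cov_le[of n u v] norm_sample_cov_le[of n u' v'] assms by fastforce
  have "?a\<^sup>2 - ?b\<^sup>2 = (?a - ?b) * (?a + ?b)" by (simp add: power2_eq_square algebra_simps)
  also have "\<dots> \<le> (8 / n) * (?a + ?b)" using ab by (intro mult_right_mono) auto
  also have "\<dots> \<le> (8 / n) * 4" using s by (intro mult_left_mono) auto
  finally show ?thesis by simp
qed

text \<open>
  For fixed \<open>k\<close> the sum is the same for all \<open>l \<noteq> k\<close>, since transposing two such indices permutes the
  permutations. The sums over all \<open>l\<close> add up to 0 because \<open>b\<close> is centred, which determines the
  common value.
\<close>

lemma sum_permuted_pairs:
  fixes b :: "nat \<Rightarrow> complex"
  assumes n: "n \<ge> 2" and b0: "(\<Sum>k=1..n. b k) = 0" and kl: "k \<in> {1..n}" "l \<in> {1..n}" "k \<noteq> l"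
  defines "R \<equiv> \<lambda>k l. \<Sum>p | p permutes {1..n}. b (p k) * cnj (b (p l))"
  shows "R k l = - R k k / of_nat (n - 1)"
proof -
  have same: "R k l' = R k l" if "l' \<in> {1..n}" "l' \<noteq> k" for l'
  proof -
    have tr: "Transposition.transpose l l' permutes {1..n}"
      by (rule permutes_swap_id) (use kl that in auto)
    have "R k l' = (\<Sum>p | p permutes {1..n}. b ((p \<circ> Transposition.transpose l l') k) *
        cnj (b ((p \<circ> Transposition.transpose l l') l')))"
      unfolding R_def by (rule sum_permutations_compose_right[OF tr])
    then show ?thesis using kl that by (simp add: R_def)
  qed
  have "(\<Sum>l'=1..n. R k l') = (\<Sum>p | p permutes {1..n}. b (p k) * cnj (\<Sum>l'=1..n. b (p l')))"
    unfolding R_def by (subst sum.swap) (simp add: sum_distrib_left)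
  also have "\<dots> = 0"
  proof (intro sum.neutral ballI)
    fix p assume "p \<in> {p. p permutes {1..n}}"
    then have "(\<Sum>l'=1..n. b (p l')) = (\<Sum>l'=1..n. b l')"
      using sum.permute[of p "{1..n}" b] by (simp add: comp_def)
    then show "b (p k) * cnj (\<Sum>l'=1..n. b (p l')) = 0" using b0 by simp
  qed
  finally have "0 = R k k + (\<Sum>l'\<in>{1..n} - {k}. R k l')"
    using sum.remove[of "{1..n}" k "R k"] kl by simp
  also have "(\<Sum>l'\<in>{1..n} - {k}. R k l') = (\<Sum>l'\<in>{1..n} - {k}. R k l)"
    by (intro sum.cong refl same) auto
  also have "\<dots> = of_nat (n - 1) * R k l" using kl by simp
  finally have "of_nat (n - 1) * R k l = - R k k" by (simp add: eq_neg_iff_add_eq_0 add.commute)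
  then show ?thesis using n by (simp add: field_simps)
qed

text \<open>
  Expanding the square gives a double sum over \<open>k\<close> and \<open>l\<close>. By the preceding lemma its off-diagonal terms
  have a weight independent of \<open>l\<close>, so they collapse, as \<open>a\<close> is centred, to a fraction \<open>1/(n - 1)\<close> of
  the diagonal. Only \<open>n\<close> terms of order \<open>fact n\<close> are left against the factor \<open>1/n\<^sup>2\<close>.
\<close>

lemma mean_permuted_sample_cov:
  assumes n: "n \<ge> 2"
    and u: "\<And>k. k \<in> {1..n} \<Longrightarrow> cmod (u k) \<le> 1" and v: "\<And>k. k \<in> {1..n} \<Longrightarrow> cmod (v k) \<le> 1"
  shows "(\<Sum>p | p permutes {1..n}. (cmod (sample_cov n u (v \<circ> p)))\<^sup>2) \<le> fact n * (32 / n)"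
proof -
  let ?P = "{p. p permutes {1..n}}"
  define a where "a = (\<lambda>k. u k - (\<Sum>k=1..n. u k) / of_nat n)"
  define b where "b = (\<lambda>k. v k - (\<Sum>k=1..n. v k) / of_nat n)"
  define R where "R = (\<lambda>k l. \<Sum>p\<in>?P. b (p k) * cnj (b (p l)))"
  have n0: "n > 0" using n by simp
  have a0: "(\<Sum>k=1..n. a k) = 0" and b0: "(\<Sum>k=1..n. b k) = 0"
    unfolding a_def b_def by (rule sum_centred[OF n0])+
  have a2: "cmod (a k) \<le> 2" if "k \<in> {1..n}" for k
    unfolding a_def using u[OF that] norm_mean_le[of n u 1] u
    by (intro order.trans[OF norm_triangle_ineq4]) auto
  have b2: "cmod (b k) \<le> 2" if "k \<in> {1..n}" for k
    unfolding b_def using v[OF that] norm_mean_le[of n v 1] v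
    by (intro order.trans[OF norm_triangle_ineq4]) auto
  have cardP: "real (card ?P) = fact n" by (simp add: card_permutations)
  have Rkk: "cmod (R k k) \<le> 4 * fact n" if k: "k \<in> {1..n}" for k
  proof -
    have "cmod (R k k) \<le> (\<Sum>p\<in>?P. 4)" unfolding R_def
    proof (rule sum_norm_le)
      fix p assume "p \<in> ?P"
      then have "cmod (b (p k)) \<le> 2" using b2 permutes_in_image[of p "{1..n}" k] k by auto
      then have "cmod (b (p k)) * cmod (b (p k)) \<le> 2 * 2" by (intro mult_mono) auto
      then show "cmod (b (p k) * cnj (b (p k))) \<le> 4" by (simp add: norm_mult)
    qed
    then show ?thesis using cardP by simp
  qed
  have cov: "sample_cov n u (v \<circ> p) = (\<Sum>k=1..n. a k * b (p k)) / of_nat n" if "p \<in> ?P" for p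
  proof -
    have "(\<Sum>k=1..n. (v \<circ> p) k) = (\<Sum>k=1..n. v k)"
      using that sum.permute[of p "{1..n}" v] by simp
    then show ?thesis by (simp add: sample_cov_centred[OF n0] a_def b_def)
  qed
  have sq: "complex_of_real ((cmod (sample_cov n u (v \<circ> p)))\<^sup>2)
      = (\<Sum>k=1..n. \<Sum>l=1..n. a k * cnj (a l) * (b (p k) * cnj (b (p l)))) / (of_nat n)\<^sup>2" if "p \<in> ?P" for p
    unfolding complex_norm_square cov[OF that]
    by (simp add: sum_product power2_eq_square mult_ac)
  have "complex_of_real (\<Sum>p\<in>?P. (cmod (sample_cov n u (v \<circ> p)))\<^sup>2)
      = (\<Sum>p\<in>?P. (\<Sum>k=1..n. \<Sum>l=1..n. a k * cnj (a l) * (b (p k) * cnj (b (p l)))) / (of_nat n)\<^sup>2)"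
    unfolding of_real_sum by (intro sum.cong refl sq)
  also have "\<dots> = (\<Sum>k=1..n. \<Sum>l=1..n. a k * cnj (a l) * R k l) / (of_nat n)\<^sup>2"
    unfolding R_def sum_divide_distrib[symmetric] sum_distrib_left
    by (subst sum.swap, subst (2) sum.swap) simp
  also have "(\<Sum>k=1..n. \<Sum>l=1..n. a k * cnj (a l) * R k l)
      = (\<Sum>k=1..n. a k * cnj (a k) * R k k * (1 + 1 / of_nat (n - 1)))"
  proof (rule sum.cong[OF refl])
    fix k assume k: "k \<in> {1..n}"
    have "(\<Sum>l=1..n. a k * cnj (a l) * R k l)
        = a k * cnj (a k) * R k k + (\<Sum>l\<in>{1..n} - {k}. a k * cnj (a l) * R k l)"
      using k by (simp add: sum.remove)
    also have "(\<Sum>l\<in>{1..n} - {k}. a k * cnj (a l) * R k l)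
        = (\<Sum>l\<in>{1..n} - {k}. a k * cnj (a l) * (- R k k / of_nat (n - 1)))"
      unfolding R_def
      by (intro sum.cong refl arg_cong2[where f = "(*)"] sum_permuted_pairs[OF n b0]) (use k in auto)
    also have "\<dots> = a k * cnj (\<Sum>l\<in>{1..n} - {k}. a l) * (- R k k / of_nat (n - 1))"
      unfolding sum_distrib_right sum_distrib_left cnj_sum by simp
    also have "(\<Sum>l\<in>{1..n} - {k}. a l) = - a k"
      using sum.remove[of "{1..n}" k a] k a0 by (simp add: eq_neg_iff_add_eq_0 add.commute)
    finally show "(\<Sum>l=1..n. a k * cnj (a l) * R k l) = a k * cnj (a k) * R k k * (1 + 1 / of_nat (n - 1))"
      by (simp add: algebra_simps)
  qed
  finally have eq: "complex_of_real (\<Sum>p\<in>?P. (cmod (sample_cov n u (v \<circ> p)))\<^sup>2)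
      = (\<Sum>k=1..n. a k * cnj (a k) * R k k * (1 + 1 / of_nat (n - 1))) / (of_nat n)\<^sup>2" .
  have "(\<Sum>p\<in>?P. (cmod (sample_cov n u (v \<circ> p)))\<^sup>2)
      = cmod (complex_of_real (\<Sum>p\<in>?P. (cmod (sample_cov n u (v \<circ> p)))\<^sup>2))"
    by (simp only: norm_of_real) (simp add: sum_nonneg)
  also have "\<dots> = cmod (\<Sum>k=1..n. a k * cnj (a k) * R k k * (1 + 1 / of_nat (n - 1))) / (real n)\<^sup>2"
    unfolding eq by (simp add: norm_divide norm_power)
  also have "\<dots> \<le> (\<Sum>k=1..n. 2 * 2 * (4 * fact n) * 2) / (real n)\<^sup>2"
  proof (intro divide_right_mono sum_norm_le)
    fix k assume k: "k \<in> {1..n}"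
    have c: "cmod (1 + 1 / of_nat (n - 1)) \<le> 2"
    proof -
      have "cmod (1 / of_nat (n - 1)) \<le> 1"
        unfolding norm_divide norm_of_nat using n by (simp add: divide_le_eq)
      then show ?thesis using norm_triangle_ineq[of 1 "1 / of_nat (n - 1) :: complex"] by simp
    qed
    show "cmod (a k * cnj (a k) * R k k * (1 + 1 / of_nat (n - 1))) \<le> 2 * 2 * (4 * fact n) * 2"
      unfolding norm_mult complex_mod_cnj
      by (intro mult_mono a2[OF k] Rkk[OF k] c) auto
  qed simp
  also have "\<dots> = fact n * (32 / n)" using n by (simp add: power2_eq_square)
  finally show ?thesis .
qed

section \<open>The statistic as an integrated squared covariance\<close>

lemma measurable_sample_cov [measurable (raw)]:
  assumes "\<And>k. k \<in> {1..n} \<Longrightarrow> u k \<in> borel_measurable M" "\<And>k. k \<in> {1..n} \<Longrightarrow> v k \<in> borel_measurable M"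
  shows "(\<lambda>x. sample_cov n (\<lambda>k. u k x) (\<lambda>k. v k x)) \<in> borel_measurable M"
  unfolding sample_cov_def
  by (intro borel_measurable_diff borel_measurable_times borel_measurable_divide borel_measurable_sum
      borel_measurable_const assms)

text \<open>
  The empirical counterpart of \<open>\<phi>\<^bsub>X,Y\<^esub>(w\<^sub>1, w\<^sub>2) - \<phi>\<^sub>X(w\<^sub>1) \<phi>\<^sub>Y(w\<^sub>2)\<close>: the joint characteristic function of the
  empirical distribution minus the product of its marginal ones.
\<close>

definition char_cov ::
  "nat \<Rightarrow> (nat \<Rightarrow> 'a::real_inner) \<Rightarrow> (nat \<Rightarrow> 'a) \<Rightarrow> 'a \<times> 'a \<Rightarrow> complex" where
  "char_cov n x y w = sample_cov n (\<lambda>k. iexp (x k \<bullet> fst w)) (\<lambda>k. iexp (y k \<bullet> snd w))"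

lemma norm_char_cov_le: "(cmod (char_cov n x y w))\<^sup>2 \<le> 4"
proof -
  have "cmod (char_cov n x y w) \<le> 2"
    unfolding char_cov_def by (rule norm_sample_cov_le) simp_all
  then show ?thesis using power_mono[of "cmod (char_cov n x y w)" 2 2] by simp
qed

lemma norm_iexp_diff_le: "cmod (iexp s - iexp t) \<le> 2"
  using norm_triangle_ineq4[of "iexp s" "iexp t"] by simp

context
  fixes \<nu> :: "'a::{real_inner, polish_space} measure"
  assumes prob: "prob_space \<nu>" and sets_eq [measurable_cong]: "sets \<nu> = sets borel"
begin

interpretation \<nu>: prob_space \<nu> by (rule prob)
interpretation \<nu>2: pair_prob_space \<nu> \<nu> ..

text \<open>
  Each term of the doubly centred kernel is an integral of \<open>u\<^sub>i cnj u\<^sub>j\<close>, and the four terms are the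
  expansion of the product of two centred factors.
\<close>

lemma Vhat_eq_integral:
  fixes x :: "nat \<Rightarrow> 'a"
  assumes n: "n > 0"
  defines "c \<equiv> \<lambda>w k. iexp (x k \<bullet> w) - (\<Sum>i=1..n. iexp (x i \<bullet> w)) / of_nat n"
  shows "Vhat \<nu> n x k l = (CLINT w|\<nu>. c w k * cnj (c w l))"
proof -
  let ?e = "\<lambda>w i j. iexp ((x i - x j) \<bullet> w)"
  have e: "?e w i j = iexp (x i \<bullet> w) * cnj (iexp (x j \<bullet> w))" for w i j
    by (simp add: exp_cnj mult_exp_exp inner_diff_left algebra_simps)
  have int: "integrable \<nu> (\<lambda>w. ?e w i j)" for i j
    by (rule \<nu>.integrable_const_bound[where B = 1]) auto
  have "c w k * cnj (c w l) = ?e w k l - 1 / of_nat n * (\<Sum>i=1..n. ?e w i l)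
      - 1 / of_nat n * (\<Sum>j=1..n. ?e w k j) + 1 / (of_nat n)\<^sup>2 * (\<Sum>i=1..n. \<Sum>j=1..n. ?e w i j)" for w
    unfolding e c_def
    by (simp add: algebra_simps sum_distrib_left[symmetric] sum_distrib_right[symmetric]
        power2_eq_square sum_product[symmetric])
  then show ?thesis
    unfolding Vhat_def hchar_def using int
    by (simp add: Bochner_Integration.integral_add Bochner_Integration.integral_diff
        Bochner_Integration.integral_sum)
qed

lemma integral_product_measure:
  fixes F G :: "'a \<Rightarrow> complex"
  assumes [measurable]: "F \<in> borel_measurable borel" "G \<in> borel_measurable borel"
    and F: "\<And>w. cmod (F w) \<le> K" and G: "\<And>w. cmod (G w) \<le> K"
  shows "(CLINT w|\<nu>. F w) * (CLINT w|\<nu>. G w) = (CLINT w|(\<nu> \<Otimes>\<^sub>M \<nu>). F (fst w) * G (snd w))"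
proof -
  have "integrable (\<nu> \<Otimes>\<^sub>M \<nu>) (\<lambda>w. F (fst w) * G (snd w))"
    by (rule \<nu>2.integrable_const_bound[where B = "K * K"])
      (auto simp: norm_mult intro!: AE_I2 mult_mono F G order.trans[OF norm_ge_zero F])
  from \<nu>2.integral_fst'[OF this] show ?thesis by simp
qed

text \<open>
  The product of the two kernels at \<open>(k, l)\<close> is an integral over \<open>(w\<^sub>1, w\<^sub>2)\<close> of \<open>z\<^sub>k cnj z\<^sub>l\<close>, where
  \<open>z\<^sub>k\<close> is the product of the centred exponentials. Summation over \<open>k\<close> and \<open>l\<close> turns it into a squared
  modulus.
\<close>

lemma dCov2_eq_integral:
  assumes n: "n > 0"
  shows "dCov2 \<nu> n x y = (LINT w|(\<nu> \<Otimes>\<^sub>M \<nu>). (cmod (char_cov n x y w))\<^sup>2)"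
proof -
  define c where "c = (\<lambda>(x::nat \<Rightarrow> 'a) w k. iexp (x k \<bullet> w) - (\<Sum>i=1..n. iexp (x i \<bullet> w)) / of_nat n)"
  have c_meas [measurable]: "(\<lambda>w. c x w k) \<in> borel_measurable borel" for x k
    unfolding c_def by measurable
  have c2: "cmod (c x w k) \<le> 2" for x w k
    unfolding c_def using norm_mean_le[of n "\<lambda>i. iexp (x i \<bullet> w)" 1]
    by (intro order.trans[OF norm_triangle_ineq4]) auto
  have cc: "cmod (c x w k * cnj (c x w l)) \<le> 4" for x w k l
    using mult_mono[OF c2[of x w k] c2[of x w l]] by (simp add: norm_mult)
  have cc_meas [measurable]: "(\<lambda>w. c x w k * cnj (c x w l)) \<in> borel_measurable borel" for x k l
    by (intro borel_measurable_times c_meas measurable_compose[OF c_meas]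
        borel_measurable_continuous_onI continuous_intros)
  let ?F = "\<lambda>k l w. (c x (fst w) k * cnj (c x (fst w) l)) * (c y (snd w) k * cnj (c y (snd w) l))"
  have Vx: "Vhat \<nu> n x k l = (CLINT w|\<nu>. c x w k * cnj (c x w l))" for x k l
    using Vhat_eq_integral[OF n, of x k l] by (simp only: c_def)
  have V: "Vhat \<nu> n x k l * Vhat \<nu> n y k l = (CLINT w|(\<nu> \<Otimes>\<^sub>M \<nu>). ?F k l w)" for k l
    unfolding Vx
    by (intro integral_product_measure[of "\<lambda>w. c x w k * cnj (c x w l)" "\<lambda>w. c y w k * cnj (c y w l)" 4]
        cc cc_meas)
  have int: "integrable (\<nu> \<Otimes>\<^sub>M \<nu>) (?F k l)" for k l
  proof (rule \<nu>2.integrable_const_bound[where B = "4 * 4"])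
    show "AE w in \<nu> \<Otimes>\<^sub>M \<nu>. cmod (?F k l w) \<le> 4 * 4"
      unfolding norm_mult[of "_ * _" "_ * _"] by (intro AE_I2 mult_mono cc) auto
  qed measurable
  have sq: "1 / (of_nat n)\<^sup>2 * (\<Sum>k=1..n. \<Sum>l=1..n. ?F k l w)
      = complex_of_real ((cmod (char_cov n x y w))\<^sup>2)" for w
  proof -
    have "char_cov n x y w = (\<Sum>k=1..n. c x (fst w) k * c y (snd w) k) / of_nat n"
      unfolding char_cov_def sample_cov_centred[OF n] by (simp add: c_def)
    then show ?thesis
      unfolding complex_norm_square
      by (simp add: sum_product power2_eq_square mult_ac)
  qed
  have "1 / (of_nat n)\<^sup>2 * (\<Sum>k=1..n. \<Sum>l=1..n. Vhat \<nu> n x k l * Vhat \<nu> n y k l)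
      = (CLINT w|(\<nu> \<Otimes>\<^sub>M \<nu>). 1 / (of_nat n)\<^sup>2 * (\<Sum>k=1..n. \<Sum>l=1..n. ?F k l w))"
    unfolding V using int
    by (simp add: Bochner_Integration.integral_sum Bochner_Integration.integrable_sum)
  also have "\<dots> = (CLINT w|(\<nu> \<Otimes>\<^sub>M \<nu>). complex_of_real ((cmod (char_cov n x y w))\<^sup>2))"
    unfolding sq ..
  also have "\<dots> = complex_of_real (LINT w|(\<nu> \<Otimes>\<^sub>M \<nu>). (cmod (char_cov n x y w))\<^sup>2)"
    by (rule integral_complex_of_real)
  finally show ?thesis unfolding dCov2_def by simp
qed

lemma measurable_char_cov [measurable]:
  "char_cov n x y \<in> borel_measurable (\<nu> \<Otimes>\<^sub>M \<nu>)"
  unfolding char_cov_def[abs_def] by measurable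

lemma integrable_char_cov: "integrable (\<nu> \<Otimes>\<^sub>M \<nu>) (\<lambda>w. (cmod (char_cov n x y w))\<^sup>2)"
  by (rule \<nu>2.integrable_const_bound[where B = 4]) (auto simp: norm_char_cov_le)

lemma dCov2_bounds:
  assumes n: "n > 0"
  shows "0 \<le> dCov2 \<nu> n x y" "dCov2 \<nu> n x y \<le> 4"
proof -
  show "0 \<le> dCov2 \<nu> n x y" unfolding dCov2_eq_integral[OF n] by simp
  have "dCov2 \<nu> n x y \<le> (LINT w|(\<nu> \<Otimes>\<^sub>M \<nu>). 4)"
    unfolding dCov2_eq_integral[OF n] by (intro integral_mono integrable_char_cov norm_char_cov_le) auto
  then show "dCov2 \<nu> n x y \<le> 4" by (simp add: \<nu>2.prob_space)
qed

lemma dCov2_stable: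
  assumes n: "n > 0"
    and d: "\<And>w1 w2. (\<Sum>k=1..n. cmod (iexp (x' k \<bullet> w1) - iexp (x k \<bullet> w1)))
      + (\<Sum>k=1..n. cmod (iexp (y' k \<bullet> w2) - iexp (y k \<bullet> w2))) \<le> 4"
  shows "dCov2 \<nu> n x' y' \<le> dCov2 \<nu> n x y + 32 / n"
proof -
  have "(LINT w|(\<nu> \<Otimes>\<^sub>M \<nu>). (cmod (char_cov n x' y' w))\<^sup>2)
      \<le> (LINT w|(\<nu> \<Otimes>\<^sub>M \<nu>). (cmod (char_cov n x y w))\<^sup>2 + 32 / n)"
  proof (rule integral_mono)
    show "(cmod (char_cov n x' y' w))\<^sup>2 \<le> (cmod (char_cov n x y w))\<^sup>2 + 32 / n" for w
      unfolding char_cov_def by (rule sample_cov_sq_stable) (use d in simp_all)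
  qed (use integrable_char_cov in auto)
  then show ?thesis
    unfolding dCov2_eq_integral[OF n] using integrable_char_cov by (simp add: \<nu>2.prob_space)
qed

lemma dCov2_change_one:
  assumes n: "n > 0" and i: "i \<in> {1..n}"
  shows "dCov2 \<nu> n (x(i := a)) (y(i := b)) \<le> dCov2 \<nu> n x y + 32 / n"
proof (rule dCov2_stable[OF n])
  have one: "(\<Sum>k=1..n. cmod (iexp ((z(i := c)) k \<bullet> w) - iexp (z k \<bullet> w))) \<le> 2" for z :: "nat \<Rightarrow> 'a" and c w
    using i norm_iexp_diff_le[of "c \<bullet> w" "z i \<bullet> w"] by (simp add: sum.remove[of _ i])
  show "(\<Sum>k=1..n. cmod (iexp ((x(i := a)) k \<bullet> w1) - iexp (x k \<bullet> w1)))
      + (\<Sum>k=1..n. cmod (iexp ((y(i := b)) k \<bullet> w2) - iexp (y k \<bullet> w2))) \<le> 4" for w1 w2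
    using one[of x a w1] one[of y b w2] by simp
qed

lemma dCov2_swap:
  assumes n: "n > 0" and p: "p permutes {1..n}" and ij: "i \<in> {1..n}" "j \<in> {1..n}"
  shows "\<bar>dCov2 \<nu> n x (y \<circ> (Transposition.transpose i j \<circ> p)) - dCov2 \<nu> n x (y \<circ> p)\<bar> \<le> 32 / n"
proof -
  let ?t = "Transposition.transpose i j"
  have sw: "(\<Sum>k=1..n. cmod (iexp (y (?t (p k)) \<bullet> w) - iexp (y (p k) \<bullet> w))) \<le> 4" for w
  proof -
    let ?g = "\<lambda>m. cmod (iexp (y (?t m) \<bullet> w) - iexp (y m \<bullet> w))"
    have "(\<Sum>k=1..n. ?g (p k)) = (\<Sum>m=1..n. ?g m)"
      using sum.permute[OF p, of ?g] by (simp add: comp_def)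
    also have "\<dots> = (\<Sum>m\<in>{i, j}. ?g m)"
      by (rule sum.mono_neutral_right) (use ij in \<open>auto simp: Transposition.transpose_def\<close>)
    also have "\<dots> \<le> (\<Sum>m\<in>{i, j}. 2)" by (intro sum_mono norm_iexp_diff_le)
    also have "\<dots> \<le> 4" by (cases "i = j") auto
    finally show ?thesis .
  qed
  have "dCov2 \<nu> n x (y \<circ> (?t \<circ> p)) \<le> dCov2 \<nu> n x (y \<circ> p) + 32 / n"
    by (rule dCov2_stable[OF n]) (use sw in \<open>simp add: comp_def\<close>)
  moreover have "dCov2 \<nu> n x (y \<circ> p) \<le> dCov2 \<nu> n x (y \<circ> (?t \<circ> p)) + 32 / n"
    by (rule dCov2_stable[OF n]) (use sw in \<open>simp add: comp_def norm_minus_commute\<close>)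
  ultimately show ?thesis by linarith
qed

text \<open>
  The averages in the kernel of the \<open>y\<close>-sample are invariant under relabelling, so permuting its indices
  is permuting the sample.
\<close>

lemma dCov2_perm_eq:
  assumes p: "p permutes {1..n}"
  shows "dCov2_perm \<nu> n x y p = dCov2 \<nu> n x (y \<circ> p)"
proof -
  have re: "(\<Sum>i=1..n. g (y (p i))) = (\<Sum>i=1..n. g (y i))" for g :: "'a \<Rightarrow> complex"
    using sum.permute[OF p, of "\<lambda>i. g (y i)"] by (simp add: comp_def)
  have "Vhat \<nu> n (y \<circ> p) k l = Vhat \<nu> n y (p k) (p l)" for k l
    unfolding Vhat_def comp_def
    using re[of "\<lambda>z. hchar \<nu> (z - y (p l))"] re[of "\<lambda>z. hchar \<nu> (y (p k) - z)"]
      re[of "\<lambda>z. \<Sum>j=1..n. hchar \<nu> (z - y (p j))"] re[of "\<lambda>z. hchar \<nu> (_ - z)"]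
    by simp
  then show ?thesis by (simp add: dCov2_perm_def dCov2_def)
qed

lemma mean_dCov2_permutations:
  assumes n: "n \<ge> 2"
  shows "(\<Sum>p | p permutes {1..n}. dCov2 \<nu> n x (y \<circ> p)) / fact n \<le> 32 / n"
proof -
  let ?P = "{p. p permutes {1..n}}"
  have n0: "n > 0" using n by simp
  have "(\<Sum>p\<in>?P. dCov2 \<nu> n x (y \<circ> p))
      = (LINT w|(\<nu> \<Otimes>\<^sub>M \<nu>). (\<Sum>p\<in>?P. (cmod (char_cov n x (y \<circ> p) w))\<^sup>2))"
    unfolding dCov2_eq_integral[OF n0]
    by (rule Bochner_Integration.integral_sum[symmetric]) (rule integrable_char_cov)
  also have "\<dots> \<le> (LINT w|(\<nu> \<Otimes>\<^sub>M \<nu>). fact n * (32 / n))"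
  proof (rule integral_mono)
    show "(\<Sum>p\<in>?P. (cmod (char_cov n x (y \<circ> p) w))\<^sup>2) \<le> fact n * (32 / n)" for w
      using mean_permuted_sample_cov[OF n, of "\<lambda>k. iexp (x k \<bullet> fst w)" "\<lambda>k. iexp (y k \<bullet> snd w)"]
      by (simp add: char_cov_def comp_def)
  qed (use integrable_char_cov in auto)
  also have "\<dots> = fact n * (32 / n)" by (simp add: \<nu>2.prob_space)
  finally show ?thesis by (simp add: field_simps)
qed

end

section \<open>Expectation of the statistic under the alternative\<close>

lemma expectation_mult_components:
  fixes U V :: "'b \<Rightarrow> complex"
  assumes M: "prob_space M" and I: "finite I" "k \<in> I" "l \<in> I" "k \<noteq> l"
    and U: "integrable M U" and V: "integrable M V"
  shows "(CLINT d|PiM I (\<lambda>_. M). U (d k) * V (d l)) = (CLINT z|M. U z) * (CLINT z|M. V z)"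
proof -
  interpret M: prob_space M by fact
  interpret product_prob_space "\<lambda>_. M" by unfold_locales
  let ?f = "\<lambda>i. if i = k then U else if i = l then V else (\<lambda>_. 1)"
  have two: "(\<Prod>i\<in>I. g i) = g k * g l" if "\<And>i. i \<in> I \<Longrightarrow> i \<noteq> k \<Longrightarrow> i \<noteq> l \<Longrightarrow> g i = 1" for g :: "_ \<Rightarrow> complex"
  proof -
    have "(\<Prod>i\<in>I. g i) = (\<Prod>i\<in>{k, l}. g i)"
      by (rule prod.mono_neutral_right) (use I that in auto)
    then show ?thesis using I by simp
  qed
  have "(CLINT d|PiM I (\<lambda>_. M). \<Prod>i\<in>I. ?f i (d i)) = (\<Prod>i\<in>I. CLINT z|M. ?f i z)"
    by (rule product_integral_prod) (use I U V in auto)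
  moreover have "(\<Prod>i\<in>I. ?f i (d i)) = U (d k) * V (d l)" for d
    using two[of "\<lambda>i. ?f i (d i)"] I by simp
  moreover have "(\<Prod>i\<in>I. CLINT z|M. ?f i z) = (CLINT z|M. U z) * (CLINT z|M. V z)"
    using two[of "\<lambda>i. CLINT z|M. ?f i z"] I by (simp add: M.prob_space)
  ultimately show ?thesis by simp
qed

lemma expectation_component:
  fixes U :: "'b \<Rightarrow> 'c::{banach, second_countable_topology}"
  assumes M: "prob_space M" and I: "k \<in> I" and U: "U \<in> borel_measurable M"
  shows "(LINT d|PiM I (\<lambda>_. M). U (d k)) = (LINT z|M. U z)"
proof -
  have "(LINT z|M. U z) = (LINT z|distr (PiM I (\<lambda>_. M)) M (\<lambda>d. d k). U z)"
    using distr_PiM_component[of I "\<lambda>_. M" k] M I by simp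
  also have "\<dots> = (LINT d|PiM I (\<lambda>_. M). U (d k))"
    by (rule integral_distr) (use I U in \<open>auto intro: measurable_component_singleton\<close>)
  finally show ?thesis by simp
qed

text \<open>
  The factor \<open>1 - 1/n\<close> is the usual bias of the sample covariance: the \<open>n\<close> diagonal terms of the product
  of the means contribute \<open>E (U V)\<close> instead of \<open>E U * E V\<close>.
\<close>

lemma expectation_sample_cov:
  fixes U V :: "'b \<Rightarrow> complex"
  assumes M: "prob_space M" and n: "n > 0"
    and [measurable]: "U \<in> borel_measurable M" "V \<in> borel_measurable M"
    and U: "\<And>z. cmod (U z) \<le> 1" and V: "\<And>z. cmod (V z) \<le> 1"
  shows "(CLINT d|PiM {1..n} (\<lambda>_. M). sample_cov n (\<lambda>k. U (d k)) (\<lambda>k. V (d k)))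
    = of_real (1 - 1 / n) * ((CLINT z|M. U z * V z) - (CLINT z|M. U z) * (CLINT z|M. V z))"
proof -
  interpret M: prob_space M by fact
  let ?P = "PiM {1..n} (\<lambda>_. M)"
  interpret PI: prob_space ?P by (intro prob_space_PiM M)
  let ?J = "CLINT z|M. U z * V z" and ?U = "CLINT z|M. U z" and ?V = "CLINT z|M. V z"
  have UV: "cmod (U z * V z') \<le> 1" for z z'
    using U[of z] V[of z'] by (simp add: norm_mult mult_le_one)
  have intU: "integrable M U" and intV: "integrable M V"
    by (rule M.integrable_const_bound[where B = 1]; use U V in auto)+
  have int: "integrable ?P (\<lambda>d. U (d k) * V (d l))" if "k \<in> {1..n}" "l \<in> {1..n}" for k l
    by (rule PI.integrable_const_bound[where B = 1]) (use UV that in auto)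
  have E: "(CLINT d|?P. U (d k) * V (d l)) = ?U * ?V + (if k = l then ?J - ?U * ?V else 0)"
    if "k \<in> {1..n}" "l \<in> {1..n}" for k l
    using expectation_mult_components[OF M _ that _ intU intV]
      expectation_component[OF M that(1), of "\<lambda>z. U z * V z"] by auto
  have cov: "sample_cov n (\<lambda>k. U (d k)) (\<lambda>k. V (d k))
      = (\<Sum>k=1..n. U (d k) * V (d k)) / of_nat n - (\<Sum>k=1..n. \<Sum>l=1..n. U (d k) * V (d l)) / (of_nat n)\<^sup>2" for d
    by (simp add: sample_cov_def sum_product power2_eq_square)
  have "(CLINT d|?P. \<Sum>k=1..n. \<Sum>l=1..n. U (d k) * V (d l))
      = (\<Sum>k=1..n. CLINT d|?P. \<Sum>l=1..n. U (d k) * V (d l))"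
    by (intro Bochner_Integration.integral_sum Bochner_Integration.integrable_sum int)
  also have "\<dots> = (\<Sum>k=1..n. \<Sum>l=1..n. CLINT d|?P. U (d k) * V (d l))"
    by (intro sum.cong refl Bochner_Integration.integral_sum int)
  finally have dbl: "(CLINT d|?P. \<Sum>k=1..n. \<Sum>l=1..n. U (d k) * V (d l))
      = (\<Sum>k=1..n. \<Sum>l=1..n. CLINT d|?P. U (d k) * V (d l))" .
  have "(CLINT d|?P. sample_cov n (\<lambda>k. U (d k)) (\<lambda>k. V (d k)))
      = (\<Sum>k=1..n. CLINT d|?P. U (d k) * V (d k)) / of_nat n
        - (\<Sum>k=1..n. \<Sum>l=1..n. CLINT d|?P. U (d k) * V (d l)) / (of_nat n)\<^sup>2"
    unfolding cov
    by (subst Bochner_Integration.integral_diff; (intro integrable_divide Bochner_Integration.integrable_sum int)?)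
      (simp_all add: dbl Bochner_Integration.integral_sum int del: One_nat_def)
  also have "(\<Sum>k=1..n. CLINT d|?P. U (d k) * V (d k)) = of_nat n * ?J"
    using E by simp
  also have "(\<Sum>k=1..n. \<Sum>l=1..n. CLINT d|?P. U (d k) * V (d l))
      = (\<Sum>k=1..n. \<Sum>l=1..n. ?U * ?V + (if k = l then ?J - ?U * ?V else 0))"
    by (intro sum.cong refl E)
  also have "\<dots> = (of_nat n)\<^sup>2 * (?U * ?V) + of_nat n * (?J - ?U * ?V)"
    by (simp add: sum.distrib power2_eq_square algebra_simps)
  also have "of_nat n * ?J / of_nat n - ((of_nat n)\<^sup>2 * (?U * ?V) + of_nat n * (?J - ?U * ?V)) / (of_nat n)\<^sup>2
      = of_real (1 - 1 / n) * (?J - ?U * ?V)"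
  proof -
    have *: "N * J / N - (N\<^sup>2 * W + N * (J - W)) / N\<^sup>2 = (1 - 1 / N) * (J - W)" if "N \<noteq> 0" for N J W :: complex
    proof -
      have "(N\<^sup>2 * W + N * (J - W)) / N\<^sup>2 = W + (J - W) / N"
        using that by (simp only: add_divide_distrib) (simp add: power2_eq_square)
      then show ?thesis using that by (simp add: left_diff_distrib)
    qed
    show ?thesis
      using *[of "of_nat n" ?J "?U * ?V"] n
      by (simp only: of_real_diff of_real_divide of_real_1 of_real_of_nat_eq of_nat_eq_0_iff)
  qed
  finally show ?thesis .
qed

lemma norm_expectation_sq_le:
  fixes Z :: "'b \<Rightarrow> complex"
  assumes M: "prob_space M" and [measurable]: "Z \<in> borel_measurable M" and Z: "\<And>x. cmod (Z x) \<le> K"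
  shows "(cmod (CLINT x|M. Z x))\<^sup>2 \<le> (LINT x|M. (cmod (Z x))\<^sup>2)"
proof -
  interpret M: prob_space M by fact
  have K: "\<bar>cmod (Z x)\<bar> \<le> \<bar>K\<bar>" for x using Z[of x] by simp
  have int: "integrable M (\<lambda>x. cmod (Z x))"
    by (rule M.integrable_const_bound[where B = "\<bar>K\<bar>"]) (use K in auto)
  have int2: "integrable M (\<lambda>x. (cmod (Z x))\<^sup>2)"
    by (rule M.integrable_const_bound[where B = "K\<^sup>2"]) (use power_mono[OF Z norm_ge_zero] in auto)
  have "cmod (CLINT x|M. Z x) \<le> (LINT x|M. cmod (Z x))" by (rule integral_norm_bound)
  then have "(cmod (CLINT x|M. Z x))\<^sup>2 \<le> (LINT x|M. cmod (Z x))\<^sup>2" by (rule power_mono) simp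
  also have "\<dots> \<le> (LINT x|M. (cmod (Z x))\<^sup>2)"
    using M.variance_eq[OF int int2] M.variance_positive[of "\<lambda>x. cmod (Z x)"] by linarith
  finally show ?thesis .
qed

lemma measurable_dCov2_sample:
  assumes \<nu>: "\<nu> \<in> sym_full_measures" and P [measurable_cong]: "sets P = sets borel"
  shows "(\<lambda>d. dCov2 \<nu> n (\<lambda>k. fst (d k)) (\<lambda>k. snd (d k))) \<in> borel_measurable (PiM {1..n} (\<lambda>_. P))"
proof -
  note [measurable] = hchar_measurable[OF \<nu>]
  have fst_P[measurable]: "fst \<in> P \<rightarrow>\<^sub>M borel" and snd_P[measurable]: "snd \<in> P \<rightarrow>\<^sub>M borel"
    unfolding measurable_cong_sets[OF P refl]
    by (auto intro!: borel_measurable_continuous_onI continuous_intros)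
  show ?thesis unfolding dCov2_def Vhat_def by measurable
qed

text \<open>
  Exchanging the two integrations reduces the claim to a pointwise one in \<open>w\<close>, which is Jensen's
  inequality for the squared modulus; \<open>n \<ge> 4\<close> gives \<open>(1 - 1/n)\<^sup>2 \<ge> 9/16\<close>.
\<close>

lemma expectation_dCov2_ge:
  fixes P :: "('a::{real_inner, polish_space} \<times> 'a) measure"
  assumes \<nu>: "\<nu> \<in> sym_full_measures" and P: "P \<in> local_alternatives \<nu> \<rho>" and n: "n \<ge> 4"
    and \<rho>: "\<rho> \<ge> 0"
  shows "\<rho> / 2 \<le> (LINT d|PiM {1..n} (\<lambda>_. P). dCov2 \<nu> n (\<lambda>k. fst (d k)) (\<lambda>k. snd (d k)))"
proof -
  have sets\<nu> [measurable_cong]: "sets \<nu> = sets borel" and prob\<nu>: "prob_space \<nu>"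
    using \<nu> by (auto simp: sym_full_measures_def)
  have setsP: "sets P = sets borel" and probP: "prob_space P"
    using P by (auto simp: local_alternatives_def)
  have [measurable_cong]: "sets P = sets (borel \<Otimes>\<^sub>M borel)"
    unfolding setsP borel_prod ..
  let ?D = "PiM {1..n} (\<lambda>_. P)" and ?N = "\<nu> \<Otimes>\<^sub>M \<nu>"
  interpret \<nu>: prob_space \<nu> by fact
  interpret P: prob_space P by fact
  interpret N: pair_prob_space \<nu> \<nu> ..
  interpret D: prob_space ?D by (intro prob_space_PiM probP)
  interpret DN: pair_prob_space ?D ?N ..
  have n0: "n > 0" using n by simp
  let ?cc = "\<lambda>d w. char_cov n (\<lambda>k. fst (d k)) (\<lambda>k. snd (d k)) w"
  let ?C = "\<lambda>w. joint_char P (fst w) (snd w) - hchar (distr P borel fst) (fst w) * hchar (distr P borel snd) (snd w)"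
  have cc_meas [measurable]: "(\<lambda>p. ?cc (fst p) (snd p)) \<in> borel_measurable (?D \<Otimes>\<^sub>M ?N)"
    unfolding char_cov_def by measurable
  have int: "integrable (?D \<Otimes>\<^sub>M ?N) (\<lambda>(d, w). (cmod (?cc d w))\<^sup>2)"
    by (rule DN.integrable_const_bound[where B = 4]) (simp_all add: norm_char_cov_le case_prod_beta' del: One_nat_def)
  have E: "(CLINT d|?D. ?cc d w) = of_real (1 - 1 / n) * ?C w" for w
  proof -
    have "(CLINT d|?D. ?cc d w) = of_real (1 - 1 / n) *
        ((CLINT z|P. iexp (fst z \<bullet> fst w) * iexp (snd z \<bullet> snd w))
         - (CLINT z|P. iexp (fst z \<bullet> fst w)) * (CLINT z|P. iexp (snd z \<bullet> snd w)))"
      unfolding char_cov_def by (rule expectation_sample_cov[OF probP n0]) auto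
    moreover have "hchar (distr P borel fst) (fst w) = (CLINT z|P. iexp (fst z \<bullet> fst w))"
      unfolding hchar_def by (subst integral_distr) (auto simp: inner_commute)
    moreover have "hchar (distr P borel snd) (snd w) = (CLINT z|P. iexp (snd z \<bullet> snd w))"
      unfolding hchar_def by (subst integral_distr) (auto simp: inner_commute)
    ultimately show ?thesis
      by (simp add: joint_char_def mult_exp_exp algebra_simps)
  qed
  have jensen: "(1 - 1 / n)\<^sup>2 * (cmod (?C w))\<^sup>2 \<le> (LINT d|?D. (cmod (?cc d w))\<^sup>2)" for w
  proof -
    have "(1 - 1 / n)\<^sup>2 * (cmod (?C w))\<^sup>2 = (cmod (CLINT d|?D. ?cc d w))\<^sup>2"
      unfolding E norm_mult norm_of_real power_mult_distrib by simp
    also have "\<dots> \<le> (LINT d|?D. (cmod (?cc d w))\<^sup>2)"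
    proof (rule norm_expectation_sq_le[OF D.prob_space_axioms, where K = 2])
      show "(\<lambda>d. ?cc d w) \<in> borel_measurable ?D"
        unfolding char_cov_def by measurable
      show "cmod (?cc d w) \<le> 2" for d
        unfolding char_cov_def by (rule norm_sample_cov_le) simp_all
    qed
    finally show ?thesis .
  qed
  have half: "1 / 2 \<le> (1 - 1 / real n)\<^sup>2"
  proof -
    have "3 / 4 \<le> 1 - 1 / real n" using n by (simp add: field_simps)
    then have "(3 / 4)\<^sup>2 \<le> (1 - 1 / real n)\<^sup>2" by (intro power_mono) auto
    then show ?thesis by (simp add: power2_eq_square)
  qed
  have "\<rho> / 2 \<le> (1 - 1 / n)\<^sup>2 * \<rho>"
    using mult_right_mono[OF half \<rho>] by simp
  also have "\<dots> \<le> (1 - 1 / n)\<^sup>2 * (LINT w|?N. (cmod (?C w))\<^sup>2)"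
    using P by (intro mult_left_mono) (auto simp: local_alternatives_def)
  also have "\<dots> = (LINT w|?N. (1 - 1 / n)\<^sup>2 * (cmod (?C w))\<^sup>2)" by simp
  also have "\<dots> \<le> (LINT w|?N. LINT d|?D. (cmod (?cc d w))\<^sup>2)"
    by (rule integral_mono') (use DN.integrable_snd[OF int] jensen in \<open>auto simp: integral_nonneg\<close>)
  also have "\<dots> = (LINT d|?D. LINT w|?N. (cmod (?cc d w))\<^sup>2)"
    by (rule DN.Fubini_integral[OF int])
  also have "\<dots> = (LINT d|?D. dCov2 \<nu> n (\<lambda>k. fst (d k)) (\<lambda>k. snd (d k)))"
    by (simp add: dCov2_eq_integral[OF prob\<nu> sets\<nu> n0])
  finally show ?thesis .
qed

section \<open>Error probability of the second kind\<close>

text \<open>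
  Acceptance means that at least \<open>\<alpha> B\<close> of the \<open>B\<close> independent permutations reach the observed value,
  while the expected number is at most \<open>\<alpha> B / 2\<close>.
\<close>

lemma accept_probability_given_data:
  fixes \<nu> :: "'a::{real_inner, polish_space} measure" and n B :: nat and d :: "nat \<Rightarrow> 'a \<times> 'a"
  defines "T \<equiv> dCov2 \<nu> n (\<lambda>k. fst (d k)) (\<lambda>k. snd (d k))"
    and "Tp \<equiv> dCov2_perm \<nu> n (\<lambda>k. fst (d k)) (\<lambda>k. snd (d k))"
    and "Q \<equiv> PiM {1..B} (\<lambda>_. uniform_count_measure {\<pi>. \<pi> permutes {1..n}})"
  assumes B: "B > 0" and \<alpha>: "\<alpha> > 0"
    and small: "real (card {\<pi>. \<pi> permutes {1..n} \<and> T \<le> Tp \<pi>}) / fact n \<le> \<alpha> / 2"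
  shows "emeasure Q {\<pi> \<in> space Q. perm_test \<nu> n B \<alpha> (d, \<pi>) = 0} \<le> ennreal (exp (- real B * \<alpha>\<^sup>2 / 2))"
proof -
  let ?S = "{\<pi>. \<pi> permutes {1..n}}"
  let ?U = "uniform_count_measure ?S"
  have fin: "finite ?S" by (simp add: finite_permutations)
  have ne: "?S \<noteq> {}" using permutes_id by blast
  have U: "prob_space ?U" by (rule prob_space_uniform_count_measure[OF fin ne])
  interpret Q: prob_space Q unfolding Q_def by (intro prob_space_PiM U)
  define g where "g = (\<lambda>\<pi>. of_bool (T \<le> Tp \<pi>) :: real)"
  define f where "f = (\<lambda>\<pi>. \<Sum>b=1..B. g (\<pi> b))"
  have g01: "0 \<le> g \<pi>" "g \<pi> \<le> 1" for \<pi> by (auto simp: g_def)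
  have g_meas: "g \<in> borel_measurable ?U"
    by (subst measurable_cong_sets[OF sets_uniform_count_measure_count_space refl]) simp
  have gb_meas: "(\<lambda>\<pi>. g (\<pi> b)) \<in> borel_measurable Q" if "b \<in> {1..B}" for b
    unfolding Q_def by (rule measurable_compose[OF measurable_component_singleton[OF that] g_meas])
  have f_meas: "f \<in> borel_measurable Q"
    unfolding f_def by (intro borel_measurable_sum gb_meas)
  have Eg: "(LINT \<pi>|Q. g (\<pi> b)) = real (card {\<pi>. \<pi> permutes {1..n} \<and> T \<le> Tp \<pi>}) / fact n"
    if b: "b \<in> {1..B}" for b
  proof -
    have "(LINT \<pi>|Q. g (\<pi> b)) = (LINT \<pi>|?U. g \<pi>)"
      unfolding Q_def by (rule expectation_component[OF U b g_meas])
    also have "\<dots> = (\<Sum>\<pi>\<in>?S. g \<pi>) / real (card ?S)"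
      by (rule integral_uniform_count_measure[OF fin])
    also have "(\<Sum>\<pi>\<in>?S. g \<pi>) = real (card {\<pi>. \<pi> permutes {1..n} \<and> T \<le> Tp \<pi>})"
      unfolding g_def using fin by (simp add: sum_of_bool_eq Int_def)
    also have "real (card ?S) = fact n" by (simp add: card_permutations)
    finally show ?thesis .
  qed
  have int: "integrable Q (\<lambda>\<pi>. g (\<pi> b))" if "b \<in> {1..B}" for b
    by (rule Q.integrable_const_bound[where B = 1]) (use gb_meas[OF that] g01 in auto)
  have "(LINT \<pi>|Q. f \<pi>) = (\<Sum>b=1..B. LINT \<pi>|Q. g (\<pi> b))"
    unfolding f_def by (rule Bochner_Integration.integral_sum[OF int])
  also have "\<dots> \<le> (\<Sum>b=1..B. \<alpha> / 2)" by (rule sum_mono) (use Eg small in simp)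
  finally have Ef: "(LINT \<pi>|Q. f \<pi>) + real B * \<alpha> / 2 \<le> real B * \<alpha>" by simp
  have "{\<pi> \<in> space Q. perm_test \<nu> n B \<alpha> (d, \<pi>) = 0} \<subseteq> {\<pi> \<in> space Q. f \<pi> \<ge> (LINT \<pi>|Q. f \<pi>) + real B * \<alpha> / 2}"
  proof safe
    fix \<pi> assume acc: "perm_test \<nu> n B \<alpha> (d, \<pi>) = 0"
    have "(\<Sum>b=1..B. of_bool (Tp (\<pi> b) < T)) = (\<Sum>b=1..B. 1 - g (\<pi> b))"
      by (intro sum.cong refl) (simp add: g_def of_bool_def not_le)
    also have "\<dots> = real B - f \<pi>" by (simp add: f_def sum_subtractf)
    finally have "1 / real B * (real B - f \<pi>) \<le> 1 - \<alpha>"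
      using acc by (simp add: perm_test_def Let_def T_def Tp_def split: if_splits)
    then have "real B * \<alpha> \<le> f \<pi>" using B by (simp add: field_simps)
    then show "f \<pi> \<ge> (LINT \<pi>|Q. f \<pi>) + real B * \<alpha> / 2" using Ef by linarith
  qed
  then have "emeasure Q {\<pi> \<in> space Q. perm_test \<nu> n B \<alpha> (d, \<pi>) = 0}
      \<le> emeasure Q {\<pi> \<in> space Q. f \<pi> \<ge> (LINT \<pi>|Q. f \<pi>) + real B * \<alpha> / 2}"
    by (rule emeasure_mono) (use f_meas in measurable)
  also have "\<dots> \<le> ennreal (exp (- 2 * (real B * \<alpha> / 2)\<^sup>2 / (card {1..B} * (1::real)\<^sup>2)))"
    unfolding Q_def
  proof (rule McDiarmid[OF U, where K = "real B"])
    show "f \<in> borel_measurable (PiM {1..B} (\<lambda>_. ?U))" using f_meas by (simp add: Q_def)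
    show "\<bar>f \<pi>\<bar> \<le> real B" for \<pi>
    proof -
      have "f \<pi> \<le> (\<Sum>b=1..B. 1)" unfolding f_def by (intro sum_mono g01)
      moreover have "0 \<le> f \<pi>" unfolding f_def by (intro sum_nonneg g01)
      ultimately show ?thesis by simp
    qed
    show "f (\<pi>(i := y)) \<le> f \<pi> + 1" if i: "i \<in> {1..B}" for \<pi> i y
    proof -
      have "f (\<pi>(i := y)) = g y + (\<Sum>b\<in>{1..B} - {i}. g (\<pi> b))"
        unfolding f_def using i by (simp add: sum.remove[of _ i])
      moreover have "f \<pi> = g (\<pi> i) + (\<Sum>b\<in>{1..B} - {i}. g (\<pi> b))"
        unfolding f_def using i by (simp add: sum.remove[of _ i])
      ultimately show ?thesis using g01[of y] g01[of "\<pi> i"] by linarith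
    qed
  qed (use B \<alpha> in auto)
  also have "- 2 * (real B * \<alpha> / 2)\<^sup>2 / (card {1..B} * (1::real)\<^sup>2) = - real B * \<alpha>\<^sup>2 / 2"
    using B by (simp add: power2_eq_square field_simps)
  finally show ?thesis .
qed

text \<open>
  The mean is at least \<open>\<rho>/2\<close>, so falling below \<open>\<rho>/4\<close> is a deviation of at least \<open>\<rho>/4\<close>.
\<close>

lemma dCov2_lower_tail:
  fixes P :: "('a::{real_inner, polish_space} \<times> 'a) measure"
  assumes \<nu>: "\<nu> \<in> sym_full_measures" and P: "P \<in> local_alternatives \<nu> \<rho>" and n: "n \<ge> 4" and \<rho>: "\<rho> > 0"
  shows "emeasure (PiM {1..n} (\<lambda>_. P))
      {d \<in> space (PiM {1..n} (\<lambda>_. P)). dCov2 \<nu> n (\<lambda>k. fst (d k)) (\<lambda>k. snd (d k)) < \<rho> / 4}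
    \<le> ennreal (exp (- real n * \<rho>\<^sup>2 / 8192))" (is "emeasure ?D {d \<in> _. ?T d < _} \<le> _")
proof -
  have sets\<nu>: "sets \<nu> = sets borel" and prob\<nu>: "prob_space \<nu>"
    using \<nu> by (auto simp: sym_full_measures_def)
  have setsP: "sets P = sets borel" and probP: "prob_space P"
    using P by (auto simp: local_alternatives_def)
  have n0: "n > 0" using n by simp
  note T_meas [measurable] = measurable_dCov2_sample[OF \<nu> setsP, of n]
  have E: "\<rho> / 2 \<le> (LINT d|?D. ?T d)"
    by (rule expectation_dCov2_ge[OF \<nu> P n]) (use \<rho> in simp)
  have "emeasure ?D {d \<in> space ?D. ?T d < \<rho> / 4}
      \<le> emeasure ?D {d \<in> space ?D. - ?T d \<ge> (LINT d|?D. - ?T d) + \<rho> / 4}"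
  proof (rule emeasure_mono)
    show "{d \<in> space ?D. ?T d < \<rho> / 4} \<subseteq> {d \<in> space ?D. - ?T d \<ge> (LINT d|?D. - ?T d) + \<rho> / 4}"
      using E by auto
  qed measurable
  also have "\<dots> \<le> ennreal (exp (- 2 * (\<rho> / 4)\<^sup>2 / (card {1..n} * (32 / n)\<^sup>2)))"
  proof (rule McDiarmid[OF probP, where K = 4])
    show "(\<lambda>d. - ?T d) \<in> borel_measurable ?D" by measurable
    show "\<bar>- ?T d\<bar> \<le> 4" for d
      using dCov2_bounds[OF prob\<nu> sets\<nu> n0, of "\<lambda>k. fst (d k)" "\<lambda>k. snd (d k)"] by simp
    show "- ?T (d(i := z)) \<le> - ?T d + 32 / n" if i: "i \<in> {1..n}" for d i z
    proof -
      have re: "(\<lambda>k. h ((d(i := z)) k))(i := h (d i)) = (\<lambda>k. h (d k))" for h :: "'a \<times> 'a \<Rightarrow> 'a"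
        by auto
      show ?thesis
        using dCov2_change_one[OF prob\<nu> sets\<nu> n0 i, of "\<lambda>k. fst ((d(i := z)) k)" "fst (d i)"
            "\<lambda>k. snd ((d(i := z)) k)" "snd (d i)"]
        unfolding re by linarith
    qed
  qed (use n0 \<rho> in auto)
  also have "- 2 * (\<rho> / 4)\<^sup>2 / (card {1..n} * (32 / n)\<^sup>2) = - real n * \<rho>\<^sup>2 / 8192"
    using n0 by (simp add: power2_eq_square field_simps)
  finally show ?thesis .
qed

lemma dCov2_perm_tail:
  fixes \<nu> :: "'a::{real_inner, polish_space} measure"
  assumes prob: "prob_space \<nu>" and sets: "sets \<nu> = sets borel" and n: "n \<ge> 2"
    and t: "t > 0" and s: "s \<ge> 32 / n + t"
  shows "real (card {\<pi>. \<pi> permutes {1..n} \<and> s \<le> dCov2_perm \<nu> n x y \<pi>}) / fact n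
    \<le> exp (- real n * t\<^sup>2 / 2048)"
proof -
  have n0: "n > 0" using n by simp
  let ?f = "\<lambda>\<pi>. dCov2 \<nu> n x (y \<circ> \<pi>)"
  let ?m = "(\<Sum>\<pi> | \<pi> permutes {1..n}. ?f \<pi>) / fact n"
  have m: "?m \<le> 32 / n" by (rule mean_dCov2_permutations[OF prob sets n])
  let ?big = "{\<pi>. \<pi> permutes {1..n} \<and> ?m + t \<le> ?f \<pi>}"
  have "{\<pi>. \<pi> permutes {1..n} \<and> s \<le> dCov2_perm \<nu> n x y \<pi>} \<subseteq> ?big"
  proof safe
    fix \<pi> assume "\<pi> permutes {1..n}" "s \<le> dCov2_perm \<nu> n x y \<pi>"
    then show "?m + t \<le> ?f \<pi>" using m s dCov2_perm_eq[OF prob sets, of \<pi> n x y] by linarith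
  qed
  moreover have "finite ?big"
    by (rule finite_subset[OF _ finite_permutations[of "{1..n}"]]) auto
  ultimately have "real (card {\<pi>. \<pi> permutes {1..n} \<and> s \<le> dCov2_perm \<nu> n x y \<pi>}) \<le> real (card ?big)"
    by (intro of_nat_mono card_mono)
  then have "real (card {\<pi>. \<pi> permutes {1..n} \<and> s \<le> dCov2_perm \<nu> n x y \<pi>}) / fact n
      \<le> real (card ?big) / fact n"
    by (rule divide_right_mono) simp
  also have "\<dots> \<le> exp (- t\<^sup>2 / (2 * n * (32 / n)\<^sup>2))"
  proof -
    have "real (card {\<pi>. \<pi> permutes {1..n} \<and>
        (\<Sum>\<pi> | \<pi> permutes {1..n}. ?f \<pi>) / fact (card {1..n}) + t \<le> ?f \<pi>}) / fact (card {1..n})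
      \<le> exp (- t\<^sup>2 / (2 * card {1..n} * (32 / n)\<^sup>2))"
      by (rule permutation_tail_bound) (use n0 t in \<open>simp_all only: finite_atLeastAtMost dCov2_swap[OF prob sets n0]\<close>, auto)
    moreover have "card {1..n} = n" by simp
    ultimately show ?thesis by (simp only:)
  qed
  also have "- t\<^sup>2 / (2 * n * (32 / n)\<^sup>2) = - real n * t\<^sup>2 / 2048"
    using n0 by (simp add: power2_eq_square field_simps)
  finally show ?thesis .
qed

text \<open>
  Conditioning on the data: the samples whose statistic is below \<open>\<rho>/4\<close> contribute at most \<open>\<beta>/2\<close>, and
  for every other sample the conditional probability of acceptance is at most \<open>\<beta>/6\<close>. The threshold
  \<open>\<rho>/4\<close> leaves room for the mean \<open>32/n \<le> \<rho>/8\<close> of the permuted statistic and a deviation of \<open>\<rho>/8\<close>.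
\<close>

lemma type_II_error_le:
  fixes P :: "('a::{real_inner, polish_space} \<times> 'a) measure"
  assumes \<nu>: "\<nu> \<in> sym_full_measures" and P: "P \<in> local_alternatives \<nu> \<rho>" and n: "n \<ge> 4"
    and \<alpha>: "\<alpha> > 0" and \<beta>: "\<beta> > 0" and B: "B > 0"
    and B_large: "exp (- real B * \<alpha>\<^sup>2 / 2) \<le> \<beta> / 6"
    and \<rho>: "256 / n \<le> \<rho>" and \<rho>_\<alpha>: "exp (- real n * \<rho>\<^sup>2 / 131072) \<le> \<alpha> / 2"
    and \<rho>_\<beta>: "exp (- real n * \<rho>\<^sup>2 / 8192) \<le> \<beta> / 2"
  shows "emeasure (test_space n B P) {\<omega> \<in> space (test_space n B P). perm_test \<nu> n B \<alpha> \<omega> = 0} \<le> ennreal \<beta>"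
proof -
  have sets\<nu>: "sets \<nu> = sets borel" and prob\<nu>: "prob_space \<nu>"
    using \<nu> by (auto simp: sym_full_measures_def)
  have setsP: "sets P = sets borel" and probP: "prob_space P"
    using P by (auto simp: local_alternatives_def)
  have "0 < 256 / real n" using n by simp
  then have \<rho>0: "\<rho> > 0" using \<rho> by linarith
  define D where "D = PiM {1..n} (\<lambda>_. P)"
  define Q where "Q = PiM {1..B} (\<lambda>_. uniform_count_measure {\<pi>. \<pi> permutes {1..n}})"
  interpret D: prob_space D unfolding D_def by (intro prob_space_PiM probP)
  have "prob_space Q" unfolding Q_def
    by (intro prob_space_PiM prob_space_uniform_count_measure)
      (auto simp: finite_permutations intro!: exI[of _ id])
  then interpret Q: prob_space Q .
  let ?T = "\<lambda>d. dCov2 \<nu> n (\<lambda>k. fst (d k)) (\<lambda>k. snd (d k))"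
  let ?A = "{\<omega> \<in> space (D \<Otimes>\<^sub>M Q). perm_test \<nu> n B \<alpha> \<omega> = 0}"
  let ?L = "{d \<in> space D. ?T d < \<rho> / 4}"
  have TS: "test_space n B P = D \<Otimes>\<^sub>M Q" by (simp add: test_space_def D_def Q_def)
  have A: "?A \<in> sets (D \<Otimes>\<^sub>M Q)" using accept_event[OF \<nu> setsP, of n B \<alpha>] by (simp add: TS)
  have T_meas [measurable]: "?T \<in> borel_measurable D"
    using measurable_dCov2_sample[OF \<nu> setsP, of n] by (simp add: D_def)
  have L: "?L \<in> sets D" by measurable
  have given_d: "emeasure Q (Pair d -` ?A) \<le> indicator ?L d + ennreal (\<beta> / 6)" if d: "d \<in> space D" for d
  proof (cases "?T d < \<rho> / 4")
    case True
    have "emeasure Q (Pair d -` ?A) \<le> 1" by (rule Q.emeasure_le_1)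
    also have "\<dots> \<le> indicator ?L d + ennreal (\<beta> / 6)" using True d by simp
    finally show ?thesis .
  next
    case False
    have "real (card {\<pi>. \<pi> permutes {1..n} \<and> ?T d \<le> dCov2_perm \<nu> n (\<lambda>k. fst (d k)) (\<lambda>k. snd (d k)) \<pi>}) / fact n
        \<le> exp (- real n * (\<rho> / 8)\<^sup>2 / 2048)"
      by (rule dCov2_perm_tail[OF prob\<nu> sets\<nu>]) (use n \<rho> \<rho>0 False in auto)
    also have "- real n * (\<rho> / 8)\<^sup>2 / 2048 = - real n * \<rho>\<^sup>2 / 131072" by (simp add: power2_eq_square)
    also note \<rho>_\<alpha>
    finally have small: "real (card {\<pi>. \<pi> permutes {1..n} \<and>
        ?T d \<le> dCov2_perm \<nu> n (\<lambda>k. fst (d k)) (\<lambda>k. snd (d k)) \<pi>}) / fact n \<le> \<alpha> / 2" .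
    have "Pair d -` ?A = {\<pi> \<in> space Q. perm_test \<nu> n B \<alpha> (d, \<pi>) = 0}"
      using d by (auto simp: space_pair_measure)
    then have "emeasure Q (Pair d -` ?A) \<le> ennreal (exp (- real B * \<alpha>\<^sup>2 / 2))"
      using accept_probability_given_data[OF B \<alpha> small] by (simp add: Q_def)
    also have "\<dots> \<le> ennreal (\<beta> / 6)" by (rule ennreal_leI[OF B_large])
    finally show ?thesis by (simp add: add_increasing)
  qed
  have "emeasure (D \<Otimes>\<^sub>M Q) ?A = (\<integral>\<^sup>+d. emeasure Q (Pair d -` ?A) \<partial>D)"
    by (rule Q.emeasure_pair_measure_alt[OF A])
  also have "\<dots> \<le> (\<integral>\<^sup>+d. indicator ?L d + ennreal (\<beta> / 6) \<partial>D)"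
    by (intro nn_integral_mono given_d)
  also have "\<dots> = emeasure D ?L + ennreal (\<beta> / 6)"
    using L by (subst nn_integral_add) (auto simp: D.emeasure_space_1)
  also have "emeasure D ?L \<le> ennreal (\<beta> / 2)"
    using order.trans[OF dCov2_lower_tail[OF \<nu> P n \<rho>0] ennreal_leI[OF \<rho>_\<beta>]] by (simp add: D_def)
  also have "ennreal (\<beta> / 2) + ennreal (\<beta> / 6) \<le> ennreal \<beta>"
    using \<beta> by (simp add: ennreal_plus[symmetric] del: ennreal_plus)
  finally show ?thesis unfolding TS by (simp add: add_mono)
qed

theorem theorem4p4:
  assumes infinite_dim: "\<nexists>S :: 'a::{real_inner, polish_space} set. finite S \<and> span S = UNIV"
  shows "\<exists>c::real. c > 0 \<and>
    (\<forall>(\<alpha>::real) (\<beta>::real) (n::nat) (B::nat).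
       0 < \<alpha> \<and> \<alpha> < 1 \<and> 0 < \<beta> \<and> \<beta> < 1 \<and> 0 < \<alpha> + \<beta> \<and> \<alpha> + \<beta> < 1 \<and> \<beta> < 1 / exp 1 \<and>
       n \<ge> 4 \<and> real B \<ge> 2 * ln (6 / \<beta>) / \<alpha>\<^sup>2 \<longrightarrow>
       uniform_separation_rate n B
           (\<lambda>\<nu>::'a measure. perm_test \<nu> n B \<alpha>) \<beta>
         \<le> ereal (c * real n powr (-1/2) * (ln (1 / \<alpha>) + ln (1 / \<beta>))))"
\<comment> \<open>The constant makes \<open>n \<rho>\<^sup>2 = 131072 * 2 L\<^sup>2\<close>, with \<open>L\<close> the sum of the two logarithms; as \<open>L \<ge> 1\<close>, the
    permutation tail is then at most \<open>exp (- 2 L) = (\<alpha> \<beta>)\<^sup>2\<close>.\<close>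
proof (intro exI[of _ 512] conjI allI impI)
  fix \<alpha> \<beta> :: real and n B :: nat
  assume "0 < \<alpha> \<and> \<alpha> < 1 \<and> 0 < \<beta> \<and> \<beta> < 1 \<and> 0 < \<alpha> + \<beta> \<and> \<alpha> + \<beta> < 1 \<and> \<beta> < 1 / exp 1 \<and>
       n \<ge> 4 \<and> real B \<ge> 2 * ln (6 / \<beta>) / \<alpha>\<^sup>2"
  then have \<alpha>: "0 < \<alpha>" "\<alpha> < 1" and \<beta>: "0 < \<beta>" "\<beta> < 1" "\<beta> < 1 / exp 1" and n: "n \<ge> 4"
    and B: "real B \<ge> 2 * ln (6 / \<beta>) / \<alpha>\<^sup>2" by auto
  define L where "L = ln (1 / \<alpha>) + ln (1 / \<beta>)"
  define \<rho> where "\<rho> = 512 * real n powr (-1/2) * L"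
  have L_eq: "exp (- L) = \<alpha> * \<beta>"
    using \<alpha> \<beta> by (simp add: L_def ln_div exp_add)
  have L1: "1 \<le> L"
  proof -
    have "exp 1 \<le> 1 / \<beta>" using \<beta> by (simp add: field_simps)
    then have "1 \<le> ln (1 / \<beta>)" using \<beta> by (simp add: ln_ge_iff)
    moreover have "0 \<le> ln (1 / \<alpha>)" using \<alpha> by simp
    ultimately show ?thesis by (simp add: L_def)
  qed
  have sqrt_n: "real n powr (-1/2) = 1 / sqrt n"
  proof -
    have "real n powr (-1/2) = inverse (real n powr (1/2))" by (simp add: powr_minus[symmetric])
    then show ?thesis by (simp only: powr_half_sqrt[OF of_nat_0_le_iff] inverse_eq_divide)
  qed
  have \<rho>_eq: "\<rho> = 512 * L / sqrt n" unfolding \<rho>_def sqrt_n by simp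
  have \<rho>_pos: "\<rho> > 0" using L1 n by (simp add: \<rho>_eq)
  have n\<rho>: "real n * \<rho>\<^sup>2 = 262144 * L\<^sup>2"
    using n by (simp add: \<rho>_eq power_mult_distrib power_divide)
  have LL: "L \<le> L\<^sup>2" using L1 by (simp add: power2_eq_square)
  have tail: "exp (- 2 * L) \<le> \<alpha> / 2" "exp (- 2 * L) \<le> \<beta> / 2"
  proof -
    \<comment> \<open>One factor \<open>exp (- L)\<close> is \<open>\<alpha> \<beta>\<close>; the other one is at most \<open>1/2\<close>.\<close>
    have e: "2 \<le> exp (1::real)" using exp_ge_add_one_self[of 1] by simp
    have "exp (- L) \<le> exp (- 1)" using L1 by simp
    also have "\<dots> \<le> 1 / 2" using e by (simp add: exp_minus field_simps)
    finally have h: "exp (- L) \<le> 1 / 2" .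
    have "exp (- 2 * L) = exp (- L) * exp (- L)" by (simp add: mult_exp_exp)
    also have "\<dots> \<le> (1 / 2) * (\<alpha> * \<beta>)"
      using h \<alpha> \<beta> unfolding L_eq by (intro mult_right_mono) auto
    finally have *: "exp (- 2 * L) \<le> \<alpha> * \<beta> / 2" by simp
    show "exp (- 2 * L) \<le> \<alpha> / 2" "exp (- 2 * L) \<le> \<beta> / 2"
      using * \<alpha> \<beta> mult_left_mono[of \<beta> 1 \<alpha>] mult_right_mono[of \<alpha> 1 \<beta>] by linarith+
  qed
  have r1: "256 / n \<le> \<rho>"
  proof -
    have "sqrt n \<ge> 1" using n by simp
    have "256 / real n = 256 / (sqrt n * sqrt n)" by simp
    also have "\<dots> \<le> 256 / (sqrt n * 1)"
      using n by (intro divide_left_mono mult_left_mono) auto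
    also have "\<dots> \<le> 512 * L / sqrt n" using n L1 by (simp add: divide_right_mono)
    finally show ?thesis by (simp only: \<rho>_eq)
  qed
  have r2: "exp (- real n * \<rho>\<^sup>2 / 131072) \<le> \<alpha> / 2"
    by (rule order.trans[OF _ tail(1)]) (use n\<rho> LL in simp)
  have r3: "exp (- real n * \<rho>\<^sup>2 / 8192) \<le> \<beta> / 2"
    by (rule order.trans[OF _ tail(2)]) (use n\<rho> LL L1 in simp)
  have ln6: "0 < ln (6 / \<beta>)" using \<beta> by (intro ln_gt_zero) (simp add: field_simps)
  have B0: "B > 0"
  proof -
    have "0 < 2 * ln (6 / \<beta>) / \<alpha>\<^sup>2" using ln6 \<alpha> by simp
    then show ?thesis using B by (simp add: order.strict_trans2)
  qed
  have B1: "exp (- real B * \<alpha>\<^sup>2 / 2) \<le> \<beta> / 6"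
  proof -
    have "ln (6 / \<beta>) \<le> real B * \<alpha>\<^sup>2 / 2" using B \<alpha> by (simp add: field_simps)
    then have "exp (- real B * \<alpha>\<^sup>2 / 2) \<le> exp (- ln (6 / \<beta>))" by simp
    also have "\<dots> = \<beta> / 6" using \<beta> by (simp add: exp_minus)
    finally show ?thesis .
  qed
  have "(SUP \<nu>::'a measure\<in>sym_full_measures. SUP P\<in>local_alternatives \<nu> \<rho>.
        emeasure (test_space n B P) {\<omega>\<in>space (test_space n B P). perm_test \<nu> n B \<alpha> \<omega> = 0}) \<le> ennreal \<beta>"
    by (intro SUP_least type_II_error_le[OF _ _ n \<alpha>(1) \<beta>(1) B0 B1 r1 r2 r3])
  then show "uniform_separation_rate n B (\<lambda>\<nu>::'a measure. perm_test \<nu> n B \<alpha>) \<beta>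
      \<le> ereal (512 * real n powr (-1/2) * (ln (1 / \<alpha>) + ln (1 / \<beta>)))"
    unfolding uniform_separation_rate_def L_def[symmetric] \<rho>_def[symmetric]
    using \<rho>_pos by (intro Inf_lower) blast
qed simp

end
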